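(* If $\Delta$ is a simplicial complex of subsets of $\{1,\dots,n\}$ with three or fewer facets, then $I_\Delta$ is a radical ideal of $R$.
   Context: $\mathbb K$ is a field, $R=\mathbb K[x_{i_1,\dots,i_n}:1\le i_j\le a_j]$, $A=(x_{i_1,\dots,i_n})$ the generic $a_1\times\dots\times a_n$ table. For a tuple $\sigma$ with $\sigma_j\in\{1,\dots,a_j\}\cup\{+\}$, $x_\sigma$ is the sum of all $x_{i_1,\dots,i_n}$ with $i_j=\sigma_j$ whenever $\sigma_j\ne+$. For $\mathscr J=\{j_1<\dots<j_m\}$ the margin $A_{\mathscr J}$ is the table whose $(i_1,\dots,i_m)$ entry is $x_\sigma$ with $\sigma_{j_r}=i_r$, $\sigma_j=+$ for $j\notin\mathscr J$. For a table $B$ with entries in $R$, $I(B)$ is the ideal generated by its generalized $2\times2$ minors $\det\begin{pmatrix} b_{i_1,\dots,i_m} & b_{j_1,\dots,j_{l-1},i_l,j_{l+1},\dots,j_m}\\ b_{i_1,\dots,i_{l-1},j_l,i_{l+1},\dots,i_m} & b_{j_1,\dots,j_m}\end{pmatrix}$, and $I_\Delta=\sum_{\mathscr J\in\Delta}I(A_{\mathscr J})$. A simplicial complex is a nonempty family of subsets closed under subsets; facets are its maximal elements. *)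

theory Defs
  imports Main "HOL-Library.Poly_Mapping"
begin

text \<open>Polynomial ring R = K[x_i : i a cell of the table]. A cell (i_1,...,i_n) is encoded
  as a function i :: nat => nat with 1 <= i j <= a j for j in {1..n} and i j = 0 otherwise.
  Polynomials are finitely supported maps from monomials (finitely supported exponent
  vectors over cells) to coefficients.\<close>

type_synonym 'k tpoly = "((nat \<Rightarrow> nat) \<Rightarrow>\<^sub>0 nat) \<Rightarrow>\<^sub>0 'k"

definition cells :: "nat \<Rightarrow> (nat \<Rightarrow> nat) \<Rightarrow> (nat \<Rightarrow> nat) set" where
  "cells n a = {i. (\<forall>j\<in>{1..n}. 1 \<le> i j \<and> i j \<le> a j) \<and> (\<forall>j. j \<notin> {1..n} \<longrightarrow> i j = 0)}"

definition var :: "(nat \<Rightarrow> nat) \<Rightarrow> 'k::comm_ring_1 tpoly" where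
  "var i = Poly_Mapping.single (Poly_Mapping.single i 1) 1"

text \<open>x_sigma, with sigma j = None standing for +.\<close>
definition xsum :: "nat \<Rightarrow> (nat \<Rightarrow> nat) \<Rightarrow> (nat \<Rightarrow> nat option) \<Rightarrow> 'k::comm_ring_1 tpoly" where
  "xsum n a \<sigma> = (\<Sum>i\<in>{i\<in>cells n a. \<forall>j\<in>{1..n}. \<sigma> j \<noteq> None \<longrightarrow> i j = the (\<sigma> j)}. var i)"

text \<open>Entry of the margin A_J at the index tuple tau (only the values tau j, j in J, matter).\<close>
definition margin :: "nat \<Rightarrow> (nat \<Rightarrow> nat) \<Rightarrow> nat set \<Rightarrow> (nat \<Rightarrow> nat) \<Rightarrow> 'k::comm_ring_1 tpoly" where
  "margin n a J \<tau> = xsum n a (\<lambda>j. if j \<in> J then Some (\<tau> j) else None)"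

definition margin_minors :: "nat \<Rightarrow> (nat \<Rightarrow> nat) \<Rightarrow> nat set \<Rightarrow> 'k::comm_ring_1 tpoly set" where
  "margin_minors n a J =
     {margin n a J i * margin n a J j - margin n a J (j(l := i l)) * margin n a J (i(l := j l)) | i j l.
        (\<forall>r\<in>J. 1 \<le> i r \<and> i r \<le> a r) \<and> (\<forall>r\<in>J. 1 \<le> j r \<and> j r \<le> a r) \<and> l \<in> J}"

definition ideal_gen :: "'a::comm_ring_1 set \<Rightarrow> 'a set" where
  "ideal_gen S = {(\<Sum>s\<in>F. c s * s) | F c. finite F \<and> F \<subseteq> S}"

definition radical_ideal :: "'a::comm_ring_1 set \<Rightarrow> bool" where
  "radical_ideal I \<longleftrightarrow> (\<forall>f k. f ^ k \<in> I \<longrightarrow> f \<in> I)"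

text \<open>I_Delta = sum over J in Delta of I(A_J) = ideal generated by the union of generators.\<close>
definition I_Delta :: "nat \<Rightarrow> (nat \<Rightarrow> nat) \<Rightarrow> nat set set \<Rightarrow> 'k::comm_ring_1 tpoly set" where
  "I_Delta n a \<Delta> = ideal_gen (\<Union>J\<in>\<Delta>. margin_minors n a J)"

definition simplicial_complex :: "nat set set \<Rightarrow> bool" where
  "simplicial_complex \<Delta> \<longleftrightarrow> \<Delta> \<noteq> {} \<and> (\<forall>F\<in>\<Delta>. \<forall>G. G \<subseteq> F \<longrightarrow> G \<in> \<Delta>)"

definition facets :: "nat set set \<Rightarrow> nat set set" where
  "facets \<Delta> = {F\<in>\<Delta>. \<forall>G\<in>\<Delta>. F \<subseteq> G \<longrightarrow> G = F}"

end

theory Submission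
  imports Defs "HOL-Library.Multiset" "HOL-Library.Extended_Nat" "HOL-Combinatorics.Permutations"
    "HOL-Computational_Algebra.Polynomial"
begin

text \<open>
  Replacing the last value of every index by the marginal value + is an invertible linear change of
  variables. In the new variables, indexed again by cells, the ideal is generated by the binomials
  exchanging one coordinate of two cells whose supports lie in a common facet. So modulo the ideal
  the monomials fall into classes, a class being a multiset of cells up to such exchanges.

  A weight on the cells with values in the naturals plus infinity that is invariant under the
  exchanges gives a homomorphism to the polynomial ring K[t], sending a variable of weight k to
  t^k and one of infinite weight to 0. If such weights separate the classes, then a suitable
  combination of them isolates one class of any given polynomial outside the ideal, so that this
  polynomial is not nilpotent modulo the ideal.

  For at most three facets the weights do separate. Either the facets do not interact in a monomial,
  or exactly two of them do, or (because two cells supported in the pairwise intersections of a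
  common facet can be exchanged into one supported in the triple intersection) all three are linked
  through a cell supported in the triple intersection. In each case the column counts in the
  interacting parts determine the class.
\<close>

section \<open>Exchange moves on multisets of cells\<close>

text \<open>A weight is additive, so it cannot tell u from v when equal multiples of them are
  equivalent; separation therefore includes the claim that such u and v are already equivalent.
  Weights with natural values alone would also be blind to a common summand: if u + w and v + w are
  equivalent, u and v receive the same weight. The value infinity on cells of w breaks this
  cancellation; algebraically it restricts to the part of the zero set where those variables vanish.
  The difficulty is to know which cells may be killed for a given monomial, and the intersections of
  the supports found in the monomial give the answer.

  The number three matters in the linked case. Each cell receives a facet containing it as label,
  and a column fits if enough labels contain its index, which bounds one label count or the sum of
  two from below. As the total is fixed, a bound on a sum of two is a bound on the third, so all
  bounds concern single counts. With four labels, sums of two counts would remain genuine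
  constraints.\<close>

text \<open>Throughout, \<open>Q j\<close> is the set of values of coordinate j, and \<open>z j\<close> is the value playing the role of
  the marginal index +; F 0, F 1, F 2 are the facets (possibly with repetitions).\<close>

definition supp :: "(nat \<Rightarrow> nat) \<Rightarrow> (nat \<Rightarrow> nat) \<Rightarrow> nat set" where
  "supp z \<sigma> = {j. \<sigma> j \<noteq> z j}"

definition cells_on :: "(nat \<Rightarrow> nat set) \<Rightarrow> (nat \<Rightarrow> nat) \<Rightarrow> nat set \<Rightarrow> (nat \<Rightarrow> nat) set" where
  "cells_on Q z G = {\<sigma>. (\<forall>j. \<sigma> j \<in> Q j) \<and> supp z \<sigma> \<subseteq> G}"

inductive swap_step :: "(nat \<Rightarrow> nat set) \<Rightarrow> (nat \<Rightarrow> nat) \<Rightarrow> (nat \<Rightarrow> nat set) \<Rightarrow>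
    (nat \<Rightarrow> nat) multiset \<Rightarrow> (nat \<Rightarrow> nat) multiset \<Rightarrow> bool" for Q z F where
  "i < 3 \<Longrightarrow> \<sigma> \<in> cells_on Q z (F i) \<Longrightarrow> \<tau> \<in> cells_on Q z (F i) \<Longrightarrow>
    swap_step Q z F (M + {#\<sigma>, \<tau>#}) (M + {#\<sigma>(l := \<tau> l), \<tau>(l := \<sigma> l)#})"

abbreviation swap_equiv where "swap_equiv Q z F \<equiv> (swap_step Q z F)\<^sup>*\<^sup>*"

lemma cells_on_mono: "G \<subseteq> H \<Longrightarrow> \<sigma> \<in> cells_on Q z G \<Longrightarrow> \<sigma> \<in> cells_on Q z H"
  by (auto simp: cells_on_def)

lemma cells_on_swap: "\<sigma> \<in> cells_on Q z G \<Longrightarrow> \<tau> \<in> cells_on Q z G \<Longrightarrow> \<sigma>(l := \<tau> l) \<in> cells_on Q z G"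
  by (auto simp: cells_on_def supp_def split: if_splits)

lemma swap_step_sym: "swap_step Q z F u v \<Longrightarrow> swap_step Q z F v u"
proof (induction rule: swap_step.induct)
  case (1 i \<sigma> \<tau> M l)
  from swap_step.intros[of i "\<sigma>(l := \<tau> l)" Q z F "\<tau>(l := \<sigma> l)" M l] 1 cells_on_swap
  show ?case by auto
qed

lemma swap_equiv_sym: "swap_equiv Q z F u v \<Longrightarrow> swap_equiv Q z F v u"
  by (induction rule: rtranclp_induct) (auto intro: converse_rtranclp_into_rtranclp swap_step_sym)

lemma swap_step_add: "swap_step Q z F u v \<Longrightarrow> swap_step Q z F (u + w) (v + w)"
proof (induction rule: swap_step.induct)
  case (1 i \<sigma> \<tau> M l)
  from swap_step.intros[of i \<sigma> Q z F \<tau> "M + w" l] 1 show ?case by (simp add: ac_simps)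
qed

lemma swap_equiv_add_right: "swap_equiv Q z F u v \<Longrightarrow> swap_equiv Q z F (u + w) (v + w)"
  by (induction rule: rtranclp_induct) (auto intro: rtranclp.rtrancl_into_rtrancl swap_step_add)

lemma swap_equiv_add:
  assumes "swap_equiv Q z F u v" "swap_equiv Q z F u' v'" shows "swap_equiv Q z F (u + u') (v + v')"
proof -
  have "swap_equiv Q z F (u + u') (v + u')" using assms(1) by (rule swap_equiv_add_right)
  moreover have "swap_equiv Q z F (v + u') (v + v')"
    using swap_equiv_add_right[OF assms(2), of v] by (simp add: ac_simps)
  ultimately show ?thesis by (rule rtranclp_trans)
qed

text \<open>Applied with auxiliary families: the constant family at one facet, and a family in which
  the third facet is replaced by a copy of another.\<close>

lemma swap_equiv_mono:
  assumes "swap_equiv Q z F' u v" and sub: "\<And>i. i < 3 \<Longrightarrow> \<exists>k<3. F' i \<subseteq> F k"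
  shows "swap_equiv Q z F u v"
proof -
  have "swap_step Q z F u v" if "swap_step Q z F' u v" for u v
    using that
  proof (induction rule: swap_step.induct)
    case (1 i \<sigma> \<tau> M l)
    then obtain k where "k < 3" "F' i \<subseteq> F k" using sub by blast
    then show ?case using 1 cells_on_mono by (intro swap_step.intros) auto
  qed
  then show ?thesis using assms(1) by (metis mono_rtranclp)
qed

section \<open>Multisets of cells as numbered slots\<close>

definition slots :: "nat \<Rightarrow> (nat \<Rightarrow> nat \<Rightarrow> nat) \<Rightarrow> (nat \<Rightarrow> nat) multiset" where
  "slots D x = image_mset x (mset_set {..D})"

definition col :: "(nat \<Rightarrow> nat) multiset \<Rightarrow> nat \<Rightarrow> nat multiset" where
  "col u j = image_mset (\<lambda>\<sigma>. \<sigma> j) u"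

definition swap_at :: "(nat \<Rightarrow> nat \<Rightarrow> nat) \<Rightarrow> nat \<Rightarrow> nat \<Rightarrow> nat \<Rightarrow> (nat \<Rightarrow> nat \<Rightarrow> nat)" where
  "swap_at x s t j = x(s := (x s)(j := x t j), t := (x t)(j := x s j))"

definition fits where
  "fits Q z D L x \<longleftrightarrow> (\<forall>s\<le>D. x s \<in> cells_on Q z (L s))"

lemma col_slots: "col (slots D x) j = image_mset (\<lambda>s. x s j) (mset_set {..D})"
  by (simp add: col_def slots_def multiset.map_comp o_def)

lemma count_col_slots: "count (col (slots D x) j) b = card {s. s \<le> D \<and> x s j = b}"
proof -
  have "{a \<in> {..D}. b = x a j} = {s. s \<le> D \<and> x s j = b}" by auto
  then show ?thesis
    by (simp add: col_slots count_image_mset' )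
qed

lemma slots_cong: "(\<And>s. s \<le> D \<Longrightarrow> x s = y s) \<Longrightarrow> slots D x = slots D y"
  by (auto simp: slots_def intro!: image_mset_cong)

lemma swap_equiv_col: "swap_equiv Q z F u v \<Longrightarrow> col u j = col v j"
proof (induction rule: rtranclp_induct)
  case (step v w)
  from step.hyps(2) have "col v j = col w j"
    by (induction rule: swap_step.induct) (auto simp: col_def)
  then show ?case using step.IH by simp
qed simp

lemma swap_equiv_swap_direct:
  assumes "i < 3" "s \<le> D" "t \<le> D" "s \<noteq> t" "x s \<in> cells_on Q z (F i)" "x t \<in> cells_on Q z (F i)"
  shows "swap_equiv Q z F (slots D x) (slots D (swap_at x s t j))"
proof -
  define R where "R = {..D} - {s, t}"
  have D: "{..D} = insert s (insert t R)" and R: "s \<notin> R" "t \<notin> R" "finite R"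
    using assms by (auto simp: R_def)
  have ms: "mset_set {..D} = mset_set R + {#s, t#}" using R assms(4) by (simp add: D)
  have "image_mset (swap_at x s t j) (mset_set R) = image_mset x (mset_set R)"
    using R by (intro image_mset_cong) (auto simp: swap_at_def)
  then have "slots D (swap_at x s t j) =
      image_mset x (mset_set R) + {#(x s)(j := x t j), (x t)(j := x s j)#}"
    using assms(4) by (simp add: slots_def ms swap_at_def)
  moreover have "slots D x = image_mset x (mset_set R) + {#x s, x t#}" by (simp add: slots_def ms)
  ultimately show ?thesis using swap_step.intros[of i "x s" Q z F "x t"] assms by auto
qed

text \<open>Slot 0 serves as a hub: it may be paired with every other slot, so that two slots lying in
  different sets can exchange an entry by three moves through the hub.\<close>

lemma swap_equiv_swap_hub:
  assumes hub: "\<And>i. i < 3 \<Longrightarrow> L 0 \<subseteq> F i" and lab: "\<And>s. s \<le> D \<Longrightarrow> \<exists>i<3. L s \<subseteq> F i"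
    and x: "fits Q z D L x" and st: "s \<le> D" "t \<le> D" "s \<noteq> t" "j \<in> L s" "j \<in> L t"
  shows "swap_equiv Q z F (slots D x) (slots D (swap_at x s t j))"
proof -
  obtain i k where i: "i < 3" "L s \<subseteq> F i" and k: "k < 3" "L t \<subseteq> F k" using lab st by blast
  have a0: "x 0 \<in> cells_on Q z (F i)" "x 0 \<in> cells_on Q z (F k)"
    and as: "x s \<in> cells_on Q z (F i)" and at: "x t \<in> cells_on Q z (F k)"
    using x hub i k st by (auto simp: fits_def intro: cells_on_mono)
  show ?thesis
  proof (cases "s = 0 \<or> t = 0")
    case True
    then show ?thesis
      using swap_equiv_swap_direct[of i s D t x] swap_equiv_swap_direct[of k s D t x] a0 as at st i k by auto
  next
    case False
    \<comment> \<open>The index j has to lie in both facets: after taking over the entry of s the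
      hub must still be supported in \<open>F k\<close>, and likewise in \<open>F i\<close> before
      the third move.\<close>
    have ji: "j \<in> F i" and jk: "j \<in> F k" using st i k by auto
    define x1 where "x1 = swap_at x 0 s j"
    define x2 where "x2 = swap_at x1 0 t j"
    have c1: "swap_equiv Q z F (slots D x) (slots D x1)"
      unfolding x1_def using swap_equiv_swap_direct[of i 0 D s x] a0 as st i False by auto
    have "x1 0 \<in> cells_on Q z (F k)" "x1 t \<in> cells_on Q z (F k)"
      using a0 as at jk False st by (auto simp: x1_def swap_at_def cells_on_def supp_def split: if_splits)
    then have c2: "swap_equiv Q z F (slots D x1) (slots D x2)"
      unfolding x2_def using swap_equiv_swap_direct[of k 0 D t x1] st k False by auto
    have "x2 0 \<in> cells_on Q z (F i)" "x2 s \<in> cells_on Q z (F i)"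
      using a0 as at ji False st
      by (auto simp: x2_def x1_def swap_at_def cells_on_def supp_def split: if_splits)
    then have c3: "swap_equiv Q z F (slots D x2) (slots D (swap_at x2 0 s j))"
      using swap_equiv_swap_direct[of i 0 D s x2] st i False by auto
    have "swap_at x2 0 s j = swap_at x s t j"
      using False st by (auto simp: x2_def x1_def swap_at_def fun_eq_iff)
    then show ?thesis using c1 c2 c3 by (metis rtranclp_trans)
  qed
qed

lemma exists_mismatch:
  assumes eq: "card {s. s \<le> (D::nat) \<and> p s = b} = card {s. s \<le> D \<and> q s = b}"
    and s: "s \<le> D" "q s = b" "p s \<noteq> b"
  shows "\<exists>t\<le>D. p t = b \<and> q t \<noteq> b"
proof (rule ccontr)
  assume "\<not> ?thesis"
  then have "{s. s \<le> D \<and> p s = b} \<subset> {s. s \<le> D \<and> q s = b}" using s by blast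
  then have "card {s. s \<le> D \<and> p s = b} < card {s. s \<le> D \<and> q s = b}"
    by (intro psubset_card_mono) auto
  then show False using eq by simp
qed

text \<open>The column is corrected as a permutation is sorted by transpositions: each exchange puts
  the right entry into slot s, and the slot t that gave it away was wrong before, so the number of
  errors drops.\<close>

lemma swap_equiv_one_column:
  assumes hub: "\<And>i. i < 3 \<Longrightarrow> L 0 \<subseteq> F i" and lab: "\<And>s. s \<le> D \<Longrightarrow> \<exists>i<3. L s \<subseteq> F i"
    and y: "fits Q z D L y"
  shows "fits Q z D L x \<Longrightarrow> (\<And>s k. s \<le> D \<Longrightarrow> k \<noteq> j \<Longrightarrow> x s k = y s k) \<Longrightarrow>
    col (slots D x) j = col (slots D y) j \<Longrightarrow> swap_equiv Q z F (slots D x) (slots D y)"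
proof (induction "card {s. s \<le> D \<and> x s j \<noteq> y s j}" arbitrary: x rule: less_induct)
  case less
  have cc: "card {s. s \<le> D \<and> x s j = b} = card {s. s \<le> D \<and> y s j = b}" for b
    using arg_cong[OF less.prems(3), of "\<lambda>c. count c b"] by (simp only: count_col_slots)
  show ?case
  proof (cases "\<exists>s\<le>D. x s j \<noteq> y s j")
    case False
    have "slots D x = slots D y"
    proof (intro slots_cong ext)
      fix s k assume "s \<le> D"
      then show "x s k = y s k" using False less.prems(2) by (cases "k = j") auto
    qed
    then show ?thesis by simp
  next
    case True
    \<comment> \<open>The exchange needs j in the label of s, which is certain only if the wanted
      entry is not the marginal one. If s wants \<open>z j\<close>, the equal counts provide another
      slot that holds \<open>z j\<close> wrongly.\<close>
    have "\<exists>s\<le>D. x s j \<noteq> y s j \<and> y s j \<noteq> z j"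
    proof -
      from True obtain s where s: "s \<le> D" "x s j \<noteq> y s j" by blast
      show ?thesis
      proof (cases "y s j = z j")
        case True
        then have "\<exists>t\<le>D. x t j = z j \<and> y t j \<noteq> z j"
          using exists_mismatch[OF cc[of "z j"] s(1)] s(2) by auto
        then show ?thesis by auto
      qed (use s in blast)
    qed
    then obtain s where s: "s \<le> D" "x s j \<noteq> y s j" "y s j \<noteq> z j" by blast
    obtain t where t: "t \<le> D" "x t j = y s j" "y t j \<noteq> y s j"
      using exists_mismatch[OF cc[of "y s j"], of s] s by blast
    have st: "s \<noteq> t" using s t by auto
    have js: "j \<in> L s" using y s by (auto simp: fits_def cells_on_def supp_def)
    have jt: "j \<in> L t" using less.prems(1) s(3) t(1,2) by (fastforce simp: fits_def cells_on_def supp_def)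
    define x' where "x' = swap_at x s t j"
    have c: "swap_equiv Q z F (slots D x) (slots D x')"
      unfolding x'_def by (rule swap_equiv_swap_hub[where L = L and F = F, OF hub lab less.prems(1) s(1) t(1) st js jt])
    have f': "fits Q z D L x'"
      unfolding fits_def
    proof (intro allI impI)
      fix r assume r: "r \<le> D"
      have xr: "x r \<in> cells_on Q z (L r)" and xs: "x s \<in> cells_on Q z (L s)" and xt: "x t \<in> cells_on Q z (L t)"
        using less.prems(1) r s t by (auto simp: fits_def)
      have "(x s)(j := x t j) \<in> cells_on Q z (L s)"
        using xs xt js by (auto simp: cells_on_def supp_def)
      moreover have "(x t)(j := x s j) \<in> cells_on Q z (L t)"
        using xs xt jt by (auto simp: cells_on_def supp_def)
      ultimately show "x' r \<in> cells_on Q z (L r)"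
        using xr by (simp add: x'_def swap_at_def)
    qed
    have e': "x' r k = y r k" if "r \<le> D" "k \<noteq> j" for r k
      using that less.prems(2) by (auto simp: x'_def swap_at_def)
    have "col (slots D x') j = col (slots D x) j" using swap_equiv_col[OF c] by simp
    then have c': "col (slots D x') j = col (slots D y) j" using less.prems(3) by simp
    have "{r. r \<le> D \<and> x' r j \<noteq> y r j} \<subset> {r. r \<le> D \<and> x r j \<noteq> y r j}"
      using s t st by (auto simp: x'_def swap_at_def)
    then have "card {r. r \<le> D \<and> x' r j \<noteq> y r j} < card {r. r \<le> D \<and> x r j \<noteq> y r j}"
      by (intro psubset_card_mono) auto
    from less.hyps[OF this f' e' c'] show ?thesis by (rule rtranclp_trans[OF c])
  qed
qed

text \<open>\<open>cells_on\<close> is a condition on each coordinate separately. So the family that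
  takes column j from y and the rest from x fits the labels too, and the columns can be treated one
  after another.\<close>

lemma swap_equiv_finite_columns:
  assumes "finite J"
    and hub: "\<And>i. i < 3 \<Longrightarrow> L 0 \<subseteq> F i" and lab: "\<And>s. s \<le> D \<Longrightarrow> \<exists>i<3. L s \<subseteq> F i"
    and y: "fits Q z D L y"
  shows "fits Q z D L x \<Longrightarrow> (\<And>s k. s \<le> D \<Longrightarrow> k \<notin> J \<Longrightarrow> x s k = y s k) \<Longrightarrow>
    (\<And>j. col (slots D x) j = col (slots D y) j) \<Longrightarrow> swap_equiv Q z F (slots D x) (slots D y)"
  using assms(1)
proof (induction J arbitrary: x)
  case empty
  have "slots D x = slots D y" by (intro slots_cong ext empty.prems(2)) auto
  then show ?case by simp
next
  case (insert j J)
  define x' where "x' = (\<lambda>s. (x s)(j := y s j))"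
  have f': "fits Q z D L x'"
    unfolding fits_def
  proof (intro allI impI)
    fix r assume "r \<le> D"
    then have "x r \<in> cells_on Q z (L r)" "y r \<in> cells_on Q z (L r)"
      using insert.prems(1) y by (auto simp: fits_def)
    then show "x' r \<in> cells_on Q z (L r)" unfolding x'_def by (rule cells_on_swap)
  qed
  have cj: "col (slots D x') j = col (slots D y) j" by (simp add: col_slots x'_def)
  have ck: "col (slots D x') k = col (slots D x) k" if "k \<noteq> j" for k
    using that by (simp add: col_slots x'_def)
  have c: "swap_equiv Q z F (slots D x) (slots D x')"
  proof (rule swap_equiv_one_column[where L = L and F = F, OF hub lab f' insert.prems(1)])
    show "x s k = x' s k" if "k \<noteq> j" for s k using that by (simp add: x'_def)
    show "col (slots D x) j = col (slots D x') j" unfolding cj by (rule insert.prems(3))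
  qed
  have c': "swap_equiv Q z F (slots D x') (slots D y)"
  proof (rule insert.IH[OF f'])
    show "x' s k = y s k" if "s \<le> D" "k \<notin> J" for s k
      using that insert.prems(2) by (auto simp: x'_def)
    show "col (slots D x') k = col (slots D y) k" for k
      using cj ck[of k] insert.prems(3)[of k] by (cases "k = j") auto
  qed
  show ?case by (rule rtranclp_trans[OF c c'])
qed

text \<open>Only columns in the finite union of the facets can differ: elsewhere all entries are
  marginal.\<close>

lemma swap_equiv_fixed_labels:
  assumes hub: "\<And>i. i < 3 \<Longrightarrow> L 0 \<subseteq> F i" and lab: "\<And>s. s \<le> D \<Longrightarrow> \<exists>i<3. L s \<subseteq> F i"
    and y: "fits Q z D L y" and fin: "\<And>i. i < 3 \<Longrightarrow> finite (F i)"
    and x: "fits Q z D L x" and cols: "\<And>j. col (slots D x) j = col (slots D y) j"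
  shows "swap_equiv Q z F (slots D x) (slots D y)"
proof (rule swap_equiv_finite_columns[where L = L and F = F and J = "\<Union>i<3. F i", OF _ _ _ y x])
  show "x s k = y s k" if sk: "s \<le> D" "k \<notin> (\<Union>i<3. F i)" for s k
  proof -
    obtain i where "i < 3" "L s \<subseteq> F i" using lab[OF sk(1)] by blast
    moreover have "k \<notin> F i" using sk(2) calculation(1) by blast
    moreover have "supp z (x s) \<subseteq> L s" "supp z (y s) \<subseteq> L s"
      using x y sk(1) unfolding fits_def cells_on_def by blast+
    ultimately have "k \<notin> supp z (x s)" "k \<notin> supp z (y s)" by blast+
    then show ?thesis by (simp add: supp_def)
  qed
  show "finite (\<Union>i<3. F i)" by (intro finite_UN_I) (simp_all add: fin)
qed (use hub lab cols in blast)+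

section \<open>Rearranging columns to prescribed supports\<close>

lemma bij_into_subset:
  assumes S: "finite S" "A \<subseteq> S" "B \<subseteq> S" "card A \<le> card B"
  shows "\<exists>p. bij_betw p S S \<and> (\<forall>s\<in>S. p s \<in> A \<longrightarrow> s \<in> B)"
proof -
  have fin: "finite A" "finite B" using S finite_subset by auto
  obtain B' where B': "B' \<subseteq> B" "card B' = card A" "finite B'"
    using obtain_subset_with_card_n[OF S(4)] by metis
  obtain h where h: "bij_betw h B' A" using finite_same_card_bij B' fin by metis
  have "card (S - B') = card (S - A)"
    using B' S fin by (simp add: card_Diff_subset subset_trans)
  then obtain k where k: "bij_betw k (S - B') (S - A)"
    using finite_same_card_bij S by (metis finite_Diff)
  define p where "p s = (if s \<in> B' then h s else k s)" for s
  have "bij_betw p B' A" using h by (rule bij_betw_cong[THEN iffD1, rotated]) (simp add: p_def)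
  moreover have "bij_betw p (S - B') (S - A)"
    using k by (rule bij_betw_cong[THEN iffD1, rotated]) (simp add: p_def)
  ultimately have "bij_betw p (B' \<union> (S - B')) (A \<union> (S - A))"
    by (rule bij_betw_combine) auto
  moreover have "B' \<union> (S - B') = S" "A \<union> (S - A) = S" using B' S by auto
  moreover have "s \<in> B" if "s \<in> S" "p s \<in> A" for s
  proof (rule ccontr)
    assume "s \<notin> B"
    then have "s \<notin> B'" using B' by auto
    then have "p s = k s" "k s \<in> S - A" using k that by (auto simp: p_def bij_betw_def)
    then show False using that by simp
  qed
  ultimately show ?thesis by auto
qed

text \<open>The columns can be permuted independently of each other, since the value sets
  \<open>Q j\<close> are the same for all slots. So there is one inequality per column: the
  non-marginal entries need enough slots whose label contains j.\<close>

lemma exists_rearrangement: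
  assumes Q: "\<And>s j. s \<le> D \<Longrightarrow> x s j \<in> Q j"
    and le: "\<And>j. card {s. s \<le> D \<and> x s j \<noteq> z j} \<le> card {s. s \<le> D \<and> j \<in> L s}"
  shows "\<exists>y. fits Q z D L y \<and> (\<forall>j. col (slots D y) j = col (slots D x) j)"
proof -
  have "\<forall>j. \<exists>p. bij_betw p {..D} {..D} \<and>
      (\<forall>s\<in>{..D}. p s \<in> {s. s \<le> D \<and> x s j \<noteq> z j} \<longrightarrow> s \<in> {s. s \<le> D \<and> j \<in> L s})"
    by (intro allI bij_into_subset) (use le in auto)
  from choice[OF this] obtain p where p': "\<forall>j. bij_betw (p j) {..D} {..D} \<and>
      (\<forall>s\<in>{..D}. p j s \<in> {s. s \<le> D \<and> x s j \<noteq> z j} \<longrightarrow> s \<in> {s. s \<le> D \<and> j \<in> L s})" ..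
  then have bij: "bij_betw (p j) {..D} {..D}" for j by blast
  have p: "j \<in> L s" if "s \<le> D" "p j s \<le> D" "x (p j s) j \<noteq> z j" for j s
    using p' that by blast
  have pD: "p j s \<le> D" if "s \<le> D" for j s
    using bij[of j] that by (auto simp: bij_betw_def)
  define y where "y s j = x (p j s) j" for s j
  have "col (slots D y) j = col (slots D x) j" for j
  proof -
    have "image_mset (p j) (mset_set {..D}) = mset_set {..D}"
      using bij[of j] by (metis bij_betw_def image_mset_mset_set)
    then have "image_mset (\<lambda>s. x s j) (image_mset (p j) (mset_set {..D})) =
        image_mset (\<lambda>s. x s j) (mset_set {..D})" by simp
    then show ?thesis by (simp add: col_slots y_def multiset.map_comp o_def)
  qed
  moreover have "fits Q z D L y"
    using Q p pD by (auto simp: fits_def cells_on_def supp_def y_def)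
  ultimately show ?thesis by auto
qed

section \<open>Monomials with a cell common to all three facets\<close>

definition lab :: "(nat \<Rightarrow> nat set) \<Rightarrow> (nat \<Rightarrow> nat) \<Rightarrow> nat \<Rightarrow> nat set" where
  "lab F f s = (if s = 0 then F 0 \<inter> F 1 \<inter> F 2 else F (f s))"

text \<open>Slot 0 is the hub and has a label of its own, so the counts run over {1..D} and have sum
  D.\<close>

definition labcount :: "nat \<Rightarrow> (nat \<Rightarrow> nat) \<Rightarrow> nat \<Rightarrow> nat" where
  "labcount D f i = card {s\<in>{1..D}. f s = i}"

lemma less_3_iff: "(i::nat) < 3 \<longleftrightarrow> i = 0 \<or> i = 1 \<or> i = 2" by auto

lemma third_index:
  assumes "i < 3" "k < 3" "i \<noteq> (k::nat)"
  obtains m where "m < 3" "m \<noteq> i" "m \<noteq> k" "\<And>r. r < 3 \<Longrightarrow> r = i \<or> r = k \<or> r = m"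
proof
  \<comment> \<open>The three indices have sum 3.\<close>
  show "3 - i - k < 3" "3 - i - k \<noteq> i" "3 - i - k \<noteq> k" using assms by (auto simp: less_3_iff)
  show "r = i \<or> r = k \<or> r = 3 - i - k" if "r < 3" for r using assms that by (auto simp: less_3_iff)
qed

lemma labcount_sum:
  assumes "\<And>s. f s < 3" shows "labcount D f 0 + labcount D f 1 + labcount D f 2 = D"
proof -
  have "{1..D} = {s\<in>{1..D}. f s = 0} \<union> {s\<in>{1..D}. f s = 1} \<union> {s\<in>{1..D}. f s = 2}"
    using assms by (auto simp: less_3_iff)
  then have "card {1..D} = card ({s\<in>{1..D}. f s = 0} \<union> {s\<in>{1..D}. f s = 1} \<union> {s\<in>{1..D}. f s = 2})"
    by presburger
  also have "\<dots> = labcount D f 0 + labcount D f 1 + labcount D f 2"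
    unfolding labcount_def by (subst card_Un_disjoint; auto)+
  finally show ?thesis by simp
qed

text \<open>For a label count (n_0, n_1, n_2) the entries of each column fit iff certain lower bounds on
  n_i and n_i + n_k hold. As the n_i have a fixed sum, these are box constraints, and hence any two
  feasible label counts are joined by feasible unit transfers.\<close>

lemma swap_equiv_labelled:
  assumes fin: "\<And>i. i < 3 \<Longrightarrow> finite (F i)" and g: "\<And>s. g s < 3" and y: "fits Q z D (lab F g) y"
  shows "(\<And>s. f s < 3) \<Longrightarrow> fits Q z D (lab F f) x \<Longrightarrow>
    (\<And>j. col (slots D x) j = col (slots D y) j) \<Longrightarrow> swap_equiv Q z F (slots D x) (slots D y)"
proof (induction "\<Sum>i<3. labcount D f i - labcount D g i" arbitrary: f x rule: less_induct)
  case less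
  note f = less.prems(1) and x = less.prems(2) and cols = less.prems(3)
  have hub: "lab F h 0 \<subseteq> F i" if "i < 3" for h i using that by (auto simp: lab_def less_3_iff)
  have lb: "\<exists>i<3. lab F h s \<subseteq> F i" if "\<And>s. h s < 3" for h s
  proof (cases "s = 0")
    case True
    then have "lab F h s \<subseteq> F 0" by (auto simp: lab_def)
    then show ?thesis by (intro exI[of _ 0]) simp
  next
    case False
    then show ?thesis using that by (auto simp: lab_def)
  qed
  have sums: "labcount D f 0 + labcount D f 1 + labcount D f 2
      = labcount D g 0 + labcount D g 1 + labcount D g 2"
    using labcount_sum f g by metis
  show ?case
  proof (cases "\<forall>i<3. labcount D f i = labcount D g i")
    case True
    \<comment> \<open>Equal label counts make f the composition of g with a permutation p of the
      slots other than 0. A reordering does not change the multiset of slots, so the case of fixed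
      labels applies.\<close>
    have "image_mset f (mset_set {1..D}) = image_mset g (mset_set {1..D})"
    proof (rule multiset_eqI)
      fix i
      have e: "count (image_mset h (mset_set {1..D})) i = labcount D h i" for h
      proof -
        have "{s \<in> {1..D}. i = h s} = {s\<in>{1..D}. h s = i}" by auto
        then show ?thesis by (simp add: count_image_mset' labcount_def)
      qed
      have "labcount D f i = labcount D g i"
      proof (cases "i < 3")
        case False
        then have "{s\<in>{1..D}. f s = i} = {}" "{s\<in>{1..D}. g s = i} = {}" using f g by auto
        then show ?thesis by (simp only: labcount_def)
      qed (use True in auto)
      then show "count (image_mset f (mset_set {1..D})) i = count (image_mset g (mset_set {1..D})) i"
        by (simp only: e)
    qed
    then obtain p where p: "p permutes {1..D}" "\<And>s. s \<in> {1..D} \<Longrightarrow> f s = g (p s)"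
      by (auto elim: image_mset_eq_implies_permutes[rotated])
    have p0: "p 0 = 0" using p(1) by (auto simp: permutes_def)
    have pr: "p s \<in> {1..D} \<longleftrightarrow> s \<in> {1..D}" for s using p(1) by (rule permutes_in_image)
    have pD: "p permutes {..D}" by (rule permutes_subset[OF p(1)]) auto
    have im: "image_mset p (mset_set {..D}) = mset_set {..D}"
      using pD by (metis image_mset_mset_set permutes_image permutes_inj_on)
    have "slots D (y \<circ> p) = slots D y"
      unfolding slots_def by (simp add: im flip: multiset.map_comp)
    moreover have "fits Q z D (lab F f) (y \<circ> p)"
      unfolding fits_def
    proof (intro allI impI)
      fix s assume "s \<le> D"
      show "(y \<circ> p) s \<in> cells_on Q z (lab F f s)"
      proof (cases "s = 0")
        case True
        then show ?thesis using y p0 by (auto simp: fits_def lab_def)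
      next
        case False
        then have s: "s \<in> {1..D}" using \<open>s \<le> D\<close> by auto
        then have "p s \<in> {1..D}" by (simp only: pr)
        then show ?thesis using y p(2)[OF s] False by (auto simp: fits_def lab_def)
      qed
    qed
    ultimately show ?thesis
      using swap_equiv_fixed_labels[where L = "lab F f" and F = F, OF hub lb[OF f] _ fin x, of "y \<circ> p"] cols by simp
  next
    case False
    have "\<exists>i<3. labcount D f i > labcount D g i"
    proof (rule ccontr)
      assume "\<not> ?thesis"
      then have "labcount D f i \<le> labcount D g i" if "i < 3" for i using that by (meson not_less)
      from this[of 0] this[of 1] this[of 2] sums
      have "\<forall>i<3. labcount D f i = labcount D g i" unfolding less_3_iff by auto
      then show False using False by simp
    qed
    moreover have "\<exists>k<3. labcount D f k < labcount D g k"
    proof (rule ccontr)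
      assume "\<not> ?thesis"
      then have "labcount D g i \<le> labcount D f i" if "i < 3" for i using that by (meson not_less)
      from this[of 0] this[of 1] this[of 2] sums
      have "\<forall>i<3. labcount D f i = labcount D g i" unfolding less_3_iff by auto
      then show False using False by simp
    qed
    ultimately obtain i k where i: "i < 3" "labcount D f i > labcount D g i"
      and k: "k < 3" "labcount D f k < labcount D g k" by blast
    have ik: "i \<noteq> k" using i k by auto
    obtain m where m: "m < 3" "m \<noteq> i" "m \<noteq> k" "\<And>r. r < 3 \<Longrightarrow> r = i \<or> r = k \<or> r = m"
      using third_index[OF i(1) k(1) ik] by blast
    have "{s\<in>{1..D}. f s = i} \<noteq> {}"
      using i(2) unfolding labcount_def by (metis card.empty not_less_zero)
    then obtain s where s: "s \<in> {1..D}" "f s = i" by auto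
    \<comment> \<open>The unit transfer from i to k: after a rearrangement the cell in slot s is to
      lie in both facets, so that its label can be changed without a move.\<close>
    define L where "L = (lab F f)(s := F i \<inter> F k)"
    define f' where "f' = f(s := k)"
    have cx: "card {t. t \<le> D \<and> x t j \<noteq> z j} \<le> card {t. t \<le> D \<and> j \<in> L t}" for j
    proof -
      have xf: "{t. t \<le> D \<and> x t j \<noteq> z j} \<subseteq> {t. t \<le> D \<and> j \<in> lab F f t}"
        using x by (auto simp: fits_def cells_on_def supp_def)
      have yg: "{t. t \<le> D \<and> y t j \<noteq> z j} \<subseteq> {t. t \<le> D \<and> j \<in> lab F g t}"
        using y by (auto simp: fits_def cells_on_def supp_def)
      have "card {t. t \<le> D \<and> x t j \<noteq> z j} = size (filter_mset (\<lambda>b. b \<noteq> z j) (col (slots D x) j))" for x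
        by (simp add: col_slots filter_mset_image_mset)
      then have xy: "card {t. t \<le> D \<and> x t j \<noteq> z j} = card {t. t \<le> D \<and> y t j \<noteq> z j}"
        using cols by simp
      show ?thesis
      proof (cases "j \<in> F i \<and> j \<notin> F k")
        case False
        then have "{t. t \<le> D \<and> j \<in> lab F f t} \<subseteq> {t. t \<le> D \<and> j \<in> L t}"
          using s by (auto simp: L_def lab_def)
        then have "{t. t \<le> D \<and> x t j \<noteq> z j} \<subseteq> {t. t \<le> D \<and> j \<in> L t}" using xf by blast
        then show ?thesis by (intro card_mono) auto
      next
        \<comment> \<open>Only for such j does slot s lose its room. The entries are counted in y
          instead, where the labels g leave room for at most \<open>D - labcount D g k\<close> of
          them if j is in \<open>F m\<close>, and for at most \<open>labcount D g i\<close>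
          otherwise. The strict inequalities at k and i pay for the lost slot.\<close>
        case True
        then have n0: "j \<notin> F 0 \<inter> F 1 \<inter> F 2" using k(1) by (auto simp: less_3_iff)
        have yle: "card {t. t \<le> D \<and> x t j \<noteq> z j} \<le> card {t. t \<le> D \<and> j \<in> lab F g t}"
          unfolding xy using yg by (intro card_mono) auto
        show ?thesis
        proof (cases "j \<in> F m")
          case jm: True
          have cD: "card ({1..D} - {t\<in>{1..D}. h t = k}) = D - labcount D h k" for h
            by (subst card_Diff_subset) (auto simp: labcount_def)
          have "{t. t \<le> D \<and> j \<in> L t} = ({1..D} - {t\<in>{1..D}. f t = k}) - {s}"
          proof (intro set_eqI)
            fix t
            show "t \<in> {t. t \<le> D \<and> j \<in> L t} \<longleftrightarrow> t \<in> ({1..D} - {t\<in>{1..D}. f t = k}) - {s}"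
              using True n0 jm s m(4)[OF f, of t] by (auto simp: L_def lab_def)
          qed
          moreover have "card ({1..D} - {t\<in>{1..D}. f t = k} - {s}) = D - labcount D f k - 1"
            using s ik cD[of f] by (simp add: card_Diff_singleton_if del: atLeastAtMost_iff)
          moreover have "{t. t \<le> D \<and> j \<in> lab F g t} \<subseteq> {1..D} - {t\<in>{1..D}. g t = k}"
            using True n0 by (auto simp: lab_def Suc_le_eq)
          then have "card {t. t \<le> D \<and> j \<in> lab F g t} \<le> card ({1..D} - {t\<in>{1..D}. g t = k})"
            by (intro card_mono) auto
          moreover have "card ({1..D} - {t\<in>{1..D}. g t = k}) = D - labcount D g k"
            by (rule cD)
          moreover have "labcount D g k \<le> D"
            unfolding labcount_def
            by (rule order_trans[OF card_mono[of "{1..D}"]]) auto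
          ultimately show ?thesis using k(2) yle by simp
        next
          case jm: False
          have "{t. t \<le> D \<and> j \<in> L t} = {t\<in>{1..D}. f t = i} - {s}"
          proof (intro set_eqI)
            fix t
            show "t \<in> {t. t \<le> D \<and> j \<in> L t} \<longleftrightarrow> t \<in> {t\<in>{1..D}. f t = i} - {s}"
              using True n0 jm s m(4)[OF f, of t] by (auto simp: L_def lab_def)
          qed
          moreover have "card ({t\<in>{1..D}. f t = i} - {s}) = labcount D f i - 1"
            using s by (simp add: labcount_def)
          moreover have "{t. t \<le> D \<and> j \<in> lab F g t} \<subseteq> {t\<in>{1..D}. g t = i}"
          proof
            fix t assume "t \<in> {t. t \<le> D \<and> j \<in> lab F g t}"
            then show "t \<in> {t\<in>{1..D}. g t = i}"
              using True n0 jm m(4)[OF g, of t] by (auto simp: lab_def split: if_splits)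
          qed
          then have "card {t. t \<le> D \<and> j \<in> lab F g t} \<le> labcount D g i"
            unfolding labcount_def by (intro card_mono) auto
          ultimately show ?thesis using i(2) yle by simp
        qed
      qed
    qed
    have "x t j \<in> Q j" if "t \<le> D" for t j using x that by (auto simp: fits_def cells_on_def)
    then obtain x' where x': "fits Q z D L x'" "\<And>j. col (slots D x') j = col (slots D x) j"
      using exists_rearrangement[of D x Q z L] cx by auto
    have "fits Q z D (lab F f) x'" "fits Q z D (lab F f') x'"
      using x'(1) s by (auto simp: fits_def L_def lab_def f'_def cells_on_def split: if_splits)
    moreover have "swap_equiv Q z F (slots D x) (slots D x')"
      by (rule swap_equiv_fixed_labels[where L = "lab F f" and F = F, OF hub lb[OF f] _ fin x]) (use calculation x' in auto)
    moreover have "swap_equiv Q z F (slots D x') (slots D y)"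
    proof (rule less.hyps)
      have "{t\<in>{1..D}. f' t = i} = {t\<in>{1..D}. f t = i} - {s}"
        "{t\<in>{1..D}. f' t = k} = insert s {t\<in>{1..D}. f t = k}"
        "{t\<in>{1..D}. f' t = m} = {t\<in>{1..D}. f t = m}"
        using s ik m by (auto simp: f'_def)
      then have lc: "labcount D f' i = labcount D f i - 1" "labcount D f' k = labcount D f k + 1"
        "labcount D f' m = labcount D f m"
        using s ik by (simp_all add: labcount_def)
      \<comment> \<open>Subtraction is truncated: as label k was in short supply, its summand stays
        0.\<close>
      have le: "labcount D f' r - labcount D g r \<le> labcount D f r - labcount D g r" if "r < 3" for r
        using m(4)[OF that] lc i k by auto
      show "(\<Sum>r<3. labcount D f' r - labcount D g r) < (\<Sum>r<3. labcount D f r - labcount D g r)"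
      proof (rule sum_strict_mono_ex1)
        show "\<exists>r\<in>{..<3}. labcount D f' r - labcount D g r < labcount D f r - labcount D g r"
          using i lc(1) by (intro bexI[of _ i]) auto
      qed (use le in auto)
      show "f' s < 3" for s using f k by (auto simp: f'_def)
    qed (use calculation x' cols in auto)
    ultimately show ?thesis by auto
  qed
qed

lemma slots_nth: "slots (length l) (\<lambda>s. (c # l) ! s) = mset (c # l)"
proof -
  have "mset (c # l) = mset (map ((!) (c # l)) [0..<length (c # l)])" by (simp only: map_nth)
  also have "\<dots> = image_mset ((!) (c # l)) (mset_set {0..<length (c # l)})"
    by (simp only: mset_map mset_upt)
  also have "{0..<length (c # l)} = {..length l}" by auto
  finally show ?thesis by (simp add: slots_def)
qed

text \<open>The numbering starts with the chosen cell because slot 0 is the one used as hub.\<close>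

lemma obtain_slots:
  assumes "c \<in># u"
  obtains D x where "u = slots D x" "x 0 = c" "size u = Suc D" "\<And>s. s \<le> D \<Longrightarrow> x s \<in># u"
proof -
  obtain l where l: "mset l = u - {#c#}" using ex_mset by blast
  then have u: "u = mset (c # l)" using assms by simp
  show thesis
  proof (rule that)
    show "u = slots (length l) (\<lambda>s. (c # l) ! s)" by (simp only: slots_nth u)
    show "size u = Suc (length l)" by (simp add: u)
    show "(c # l) ! s \<in># u" if "s \<le> length l" for s
      using nth_mem[of s "c # l"] that by (simp add: u)
  qed simp
qed

lemma size_col: "size (col u j) = size u" by (simp add: col_def)

lemma count_col: "count (col u j) b = size (filter_mset (\<lambda>\<sigma>. \<sigma> j = b) u)"
  by (induction u) (auto simp: col_def)

text \<open>The cells c and d, which may differ, become the hubs in slot 0. Every other cell is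
  labelled by some facet that contains it, and any choice of labels will do.\<close>

lemma swap_equiv_central:
  assumes fin: "\<And>i. i < 3 \<Longrightarrow> finite (F i)"
    and u: "\<And>\<sigma>. \<sigma> \<in># u \<Longrightarrow> \<exists>i<3. \<sigma> \<in> cells_on Q z (F i)"
    and v: "\<And>\<sigma>. \<sigma> \<in># v \<Longrightarrow> \<exists>i<3. \<sigma> \<in> cells_on Q z (F i)"
    and c: "c \<in># u" "\<And>i. i < 3 \<Longrightarrow> c \<in> cells_on Q z (F i)"
    and d: "d \<in># v" "\<And>i. i < 3 \<Longrightarrow> d \<in> cells_on Q z (F i)"
    and cols: "\<And>j. col u j = col v j"
  shows "swap_equiv Q z F u v"
proof -
  obtain D x where x: "u = slots D x" "x 0 = c" "size u = Suc D" "\<And>s. s \<le> D \<Longrightarrow> x s \<in># u"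
    using obtain_slots[OF c(1)] by blast
  obtain E y where y: "v = slots E y" "y 0 = d" "size v = Suc E" "\<And>s. s \<le> E \<Longrightarrow> y s \<in># v"
    using obtain_slots[OF d(1)] by blast
  have "size u = size v" using cols[of 0] size_col by metis
  then have ED: "E = D" using x y by simp
  have lab: "\<exists>f. (\<forall>s. f s < 3) \<and> fits Q z D (lab F f) x"
    if "\<And>s. s \<le> D \<Longrightarrow> \<exists>i<3. x s \<in> cells_on Q z (F i)" "\<And>i. i < 3 \<Longrightarrow> x 0 \<in> cells_on Q z (F i)" for x
  proof -
    have "\<forall>s. \<exists>i. i < 3 \<and> (s \<le> D \<longrightarrow> x s \<in> cells_on Q z (F i))"
    proof
      fix s show "\<exists>i. i < 3 \<and> (s \<le> D \<longrightarrow> x s \<in> cells_on Q z (F i))"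
      proof (cases "s \<le> D")
        case True then show ?thesis using that(1)[OF True] by blast
      next
        case False then show ?thesis by (intro exI[of _ 0]) simp
      qed
    qed
    from choice[OF this] obtain f where f: "\<forall>s. f s < 3 \<and> (s \<le> D \<longrightarrow> x s \<in> cells_on Q z (F (f s)))" ..
    have "x 0 \<in> cells_on Q z (F 0 \<inter> F 1 \<inter> F 2)"
      using that(2)[of 0] that(2)[of 1] that(2)[of 2] by (simp add: cells_on_def)
    then have "fits Q z D (lab F f) x" using f by (simp add: fits_def lab_def)
    then show ?thesis using f by blast
  qed
  obtain f where f: "\<forall>s. f s < 3" "fits Q z D (lab F f) x"
    using lab[of x] u x(4) c(2) x(2) by blast
  obtain g where g: "\<forall>s. g s < 3" "fits Q z D (lab F g) y"
    using lab[of y] v y(4) d(2) y(2) ED by blast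
  show ?thesis
    unfolding x(1) y(1) ED
    by (rule swap_equiv_labelled[where f = f and g = g])
      (use fin f g cols x(1) y(1) ED in simp_all)
qed

text \<open>Relative to a single facet every cell can be the hub, so this is the central case for
  the constant family at \<open>F i\<close>.\<close>

lemma swap_equiv_single:
  assumes "i < 3" "finite (F i)" "\<And>\<sigma>. \<sigma> \<in># u \<Longrightarrow> \<sigma> \<in> cells_on Q z (F i)"
    "\<And>\<sigma>. \<sigma> \<in># v \<Longrightarrow> \<sigma> \<in> cells_on Q z (F i)" "\<And>j. col u j = col v j"
  shows "swap_equiv Q z F u v"
proof (cases "u = {#}")
  case True
  then have "v = {#}" using assms(5)[of 0] by (simp add: col_def)
  then show ?thesis using True by simp
next
  case False
  then obtain c where c: "c \<in># u" by blast
  have "v \<noteq> {#}" using assms(5)[of 0] False by (auto simp: col_def)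
  then obtain d where d: "d \<in># v" by blast
  have "swap_equiv Q z (\<lambda>_. F i) u v"
    by (rule swap_equiv_central[OF _ _ _ c _ d]) (use assms c d in \<open>auto intro: exI[of _ 0]\<close>)
  then show ?thesis by (rule swap_equiv_mono) (use assms(1) in blast)
qed

text \<open>Inside one facet the columns can be rearranged freely, so a single cell can collect the
  marginal value of every column in which it occurs. Its support is then contained in the
  intersection of all supports, which is how cells common to several facets are produced. Cells
  outside the facet are kept, which allows repeated use with different facets.\<close>

lemma gather:
  assumes i: "i < 3" "finite (F i)" and c: "c \<in># u" "c \<in> cells_on Q z (F i)"
  shows "\<exists>u' e. swap_equiv Q z F u u' \<and> e \<in># u' \<and> e \<in> cells_on Q z (F i) \<and>
    (\<forall>\<sigma>\<in>#u. \<sigma> \<in> cells_on Q z (F i) \<longrightarrow> supp z e \<subseteq> supp z \<sigma>) \<and>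
    (\<forall>\<sigma>\<in>#u. \<sigma> \<notin> cells_on Q z (F i) \<longrightarrow> \<sigma> \<in># u')"
proof -
  define A where "A = filter_mset (\<lambda>\<sigma>. \<sigma> \<in> cells_on Q z (F i)) u"
  define B where "B = filter_mset (\<lambda>\<sigma>. \<sigma> \<notin> cells_on Q z (F i)) u"
  have u: "u = A + B" by (simp add: A_def B_def flip: multiset_partition)
  have "c \<in># A" using c by (simp add: A_def)
  then obtain D x where x: "A = slots D x" "\<And>s. s \<le> D \<Longrightarrow> x s \<in># A"
    using obtain_slots by metis
  have xa: "x s \<in> cells_on Q z (F i)" if "s \<le> D" for s using x(2)[OF that] by (simp add: A_def)
  define W where "W = (\<Inter>\<sigma>\<in>set_mset A. supp z \<sigma>)"
  define L where "L s = (if s = 0 then W else F i)" for s :: nat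
  have WF: "W \<subseteq> F i" using \<open>c \<in># A\<close> c by (auto simp: W_def cells_on_def)
  have A: "set_mset A = x ` {..D}" by (simp add: x(1) slots_def)
  have cx: "card {s. s \<le> D \<and> x s j \<noteq> z j} \<le> card {s. s \<le> D \<and> j \<in> L s}" for j
  proof (cases "j \<in> F i")
    case False
    then have "{s. s \<le> D \<and> x s j \<noteq> z j} = {}" using xa by (auto simp: cells_on_def supp_def)
    then show ?thesis by (simp only: card.empty)
  next
    case jF: True
    show ?thesis
    proof (cases "j \<in> W")
      case True
      then show ?thesis using jF by (intro card_mono) (auto simp: L_def)
    next
      \<comment> \<open>Some cell has the marginal value in column j; it goes to slot 0, and the
        remaining D slots have room for everything else.\<close>
      case False
      then obtain s where s: "s \<le> D" "x s j = z j" by (auto simp: W_def A supp_def)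
      then have "{s. s \<le> D \<and> x s j \<noteq> z j} \<subseteq> {..D} - {s}" by auto
      then have "card {s. s \<le> D \<and> x s j \<noteq> z j} \<le> card ({..D} - {s})" by (intro card_mono) auto
      moreover have "card ({..D} - {s}) = D" using s by simp
      moreover have "{s. s \<le> D \<and> j \<in> L s} = {1..D}" using jF False by (auto simp: L_def)
      ultimately show ?thesis by simp
    qed
  qed
  have "x s j \<in> Q j" if "s \<le> D" for s j using xa[OF that] by (simp add: cells_on_def)
  then obtain y where y: "fits Q z D L y" "\<And>j. col (slots D y) j = col (slots D x) j"
    using exists_rearrangement[of D x Q z L] cx by auto
  have ya: "y s \<in> cells_on Q z (F i)" if "s \<le> D" for s
    using y(1) that WF by (auto simp: fits_def L_def cells_on_def split: if_splits)
  have "swap_equiv Q z F A (slots D y)"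
    by (rule swap_equiv_single[where F = F and i = i, OF i]) (use xa ya y(2) in \<open>auto simp: x(1) slots_def\<close>)
  then have "swap_equiv Q z F u (slots D y + B)" unfolding u by (rule swap_equiv_add_right)
  moreover have "y 0 \<in># slots D y" by (simp add: slots_def)
  moreover have "supp z (y 0) \<subseteq> W" using y(1)[unfolded fits_def, rule_format, of 0] by (simp add: L_def cells_on_def)
  then have "\<forall>\<sigma>\<in>#u. \<sigma> \<in> cells_on Q z (F i) \<longrightarrow> supp z (y 0) \<subseteq> supp z \<sigma>"
    by (auto simp: W_def A_def)
  moreover have "\<forall>\<sigma>\<in>#u. \<sigma> \<notin> cells_on Q z (F i) \<longrightarrow> \<sigma> \<in># slots D y + B" by (simp add: B_def)
  ultimately show ?thesis using ya[of 0] by (intro exI[of _ "slots D y + B"] exI[of _ "y 0"]) auto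
qed

section \<open>Invariant weights\<close>

definition weight :: "((nat \<Rightarrow> nat) \<Rightarrow> enat) \<Rightarrow> (nat \<Rightarrow> nat) multiset \<Rightarrow> enat" where
  "weight w u = (\<Sum>\<sigma>\<in>#u. w \<sigma>)"

definition inv_weight :: "(nat \<Rightarrow> nat set) \<Rightarrow> (nat \<Rightarrow> nat) \<Rightarrow> (nat \<Rightarrow> nat set) \<Rightarrow> ((nat \<Rightarrow> nat) \<Rightarrow> enat) \<Rightarrow> bool" where
  "inv_weight Q z F w \<longleftrightarrow> (\<forall>i<3. \<forall>\<sigma>\<in>cells_on Q z (F i). \<forall>\<tau>\<in>cells_on Q z (F i). \<forall>l.
     w \<sigma> + w \<tau> = w (\<sigma>(l := \<tau> l)) + w (\<tau>(l := \<sigma> l)))"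

definition weight_equiv where
  "weight_equiv Q z F u v \<longleftrightarrow> (\<forall>w. inv_weight Q z F w \<longrightarrow> weight w u = weight w v)"

lemma weight_empty [simp]: "weight w {#} = 0" and weight_add_mset [simp]: "weight w (add_mset \<sigma> u) = w \<sigma> + weight w u"
  and weight_plus [simp]: "weight w (u + v) = weight w u + weight w v"
  by (simp_all add: weight_def)

lemma weight_cong: "(\<And>\<sigma>. \<sigma> \<in># u \<Longrightarrow> w \<sigma> = w' \<sigma>) \<Longrightarrow> weight w u = weight w' u"
  by (auto simp: weight_def intro!: arg_cong[of _ _ sum_mset] image_mset_cong)

lemma weight_eq_infinity: "\<sigma> \<in># u \<Longrightarrow> w \<sigma> = \<infinity> \<Longrightarrow> weight w u = \<infinity>"
  by (metis insert_DiffM plus_enat_simps(2) weight_add_mset)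

lemma weight_indicator: "weight (\<lambda>\<sigma>. if P \<sigma> then 1 else 0) u = enat (size (filter_mset P u))"
  by (induction u) (auto simp: one_enat_def plus_enat_simps(1) zero_enat_def)

lemma swap_equiv_weight:
  assumes "swap_equiv Q z F u v" "inv_weight Q z F w" shows "weight w u = weight w v"
  using assms(1)
proof (induction rule: rtranclp_induct)
  case (step a b)
  from step.hyps(2) have "weight w a = weight w b"
  proof cases
    case (1 i \<sigma> \<tau> M l)
    then have "w \<sigma> + w \<tau> = w (\<sigma>(l := \<tau> l)) + w (\<tau>(l := \<sigma> l))"
      using assms(2) unfolding inv_weight_def by blast
    then show ?thesis using 1 by (simp add: ac_simps)
  qed
  then show ?case using step.IH by simp
qed simp

lemma weight_equiv_sym: "weight_equiv Q z F u v \<Longrightarrow> weight_equiv Q z F v u" by (simp add: weight_equiv_def)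

lemma weight_equiv_swap_equiv: "weight_equiv Q z F u v \<Longrightarrow> swap_equiv Q z F u u' \<Longrightarrow> swap_equiv Q z F v v' \<Longrightarrow> weight_equiv Q z F u' v'"
  using swap_equiv_weight unfolding weight_equiv_def by metis

text \<open>The number of entries b in column j is itself an invariant weight.\<close>

lemma weight_equiv_col: assumes "weight_equiv Q z F u v" shows "col u j = col v j"
proof (rule multiset_eqI)
  fix b
  have "inv_weight Q z F (\<lambda>\<sigma>. if \<sigma> j = b then 1 else 0)" by (auto simp: inv_weight_def)
  then have "weight (\<lambda>\<sigma>. if \<sigma> j = b then 1 else 0) u = weight (\<lambda>\<sigma>. if \<sigma> j = b then 1 else 0) v"
    using assms by (simp add: weight_equiv_def)
  then show "count (col u j) b = count (col v j) b"
    by (simp add: weight_indicator count_col)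
qed

text \<open>The indices are grouped into blocks by \<open>blk\<close>, and each block B carries a set \<open>W B\<close> not contained in
  the \<open>F i\<close> outside of B. Killing every variable whose support does not contain the \<open>W B\<close> of its block
  is compatible with the moves, and afterwards the blocks do not interact.\<close>

lemma weight_equiv_blocks:
  fixes blk :: "nat \<Rightarrow> nat"
  assumes W: "\<And>i k. i < 3 \<Longrightarrow> k < 3 \<Longrightarrow> blk i \<noteq> blk k \<Longrightarrow> \<not> W (blk i) \<subseteq> F k"
    and u: "\<And>\<sigma>. \<sigma> \<in># u \<Longrightarrow> \<exists>i<3. \<sigma> \<in> cells_on Q z (F i) \<and> W (blk i) \<subseteq> supp z \<sigma>"
    and v: "\<And>\<sigma>. \<sigma> \<in># v \<Longrightarrow> \<exists>i<3. \<sigma> \<in> cells_on Q z (F i)"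
    and weight_equiv: "weight_equiv Q z F u v"
  shows "\<And>\<sigma> i. \<sigma> \<in># v \<Longrightarrow> i < 3 \<Longrightarrow> \<sigma> \<in> cells_on Q z (F i) \<Longrightarrow> W (blk i) \<subseteq> supp z \<sigma>"
    and "\<And>B j. col (filter_mset (\<lambda>\<sigma>. \<exists>i<3. blk i = B \<and> \<sigma> \<in> cells_on Q z (F i)) u) j =
      col (filter_mset (\<lambda>\<sigma>. \<exists>i<3. blk i = B \<and> \<sigma> \<in> cells_on Q z (F i)) v) j"
proof -
  define inB where "inB B \<sigma> \<longleftrightarrow> (\<exists>i<3. blk i = B \<and> \<sigma> \<in> cells_on Q z (F i))" for B \<sigma>
  define K where "K \<sigma> \<longleftrightarrow> (\<forall>i<3. \<sigma> \<in> cells_on Q z (F i) \<longrightarrow> W (blk i) \<subseteq> supp z \<sigma>)" for \<sigma>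
  \<comment> \<open>On surviving cells this counts the entries b of column j in the block B; the
    killed cells, those violating \<open>K\<close>, have infinite weight.\<close>
  define w :: "nat \<Rightarrow> nat \<Rightarrow> nat \<Rightarrow> (nat \<Rightarrow> nat) \<Rightarrow> enat" where
    "w B j b \<sigma> = (if K \<sigma> then if inB B \<sigma> \<and> \<sigma> j = b then 1 else 0 else \<infinity>)" for B j b \<sigma>
  \<comment> \<open>By the hypothesis on \<open>W\<close> a surviving cell belongs to facets of one
    block only, so survival can be tested at any facet that contains the cell.\<close>
  have blk_eq: "blk i = blk k"
    if "i < 3" "k < 3" "\<rho> \<in> cells_on Q z (F k)" "W (blk i) \<subseteq> supp z \<rho>" for i k \<rho>
    using W[OF that(1,2)] that by (auto simp: cells_on_def)
  have K_iff: "K \<rho> \<longleftrightarrow> W (blk i) \<subseteq> supp z \<rho>" if "i < 3" "\<rho> \<in> cells_on Q z (F i)" for i \<rho>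
    using that blk_eq unfolding K_def by metis
  have inB_iff: "inB B \<rho> \<longleftrightarrow> blk i = B" if "i < 3" "\<rho> \<in> cells_on Q z (F i)" "K \<rho>" for i \<rho> B
    using that blk_eq K_iff unfolding inB_def by metis
  have inv: "inv_weight Q z F (w B j b)" for B j b
    unfolding inv_weight_def
  proof (intro allI impI ballI)
    fix i \<sigma> \<tau> l assume i: "i < (3::nat)" "\<sigma> \<in> cells_on Q z (F i)" "\<tau> \<in> cells_on Q z (F i)"
    define \<sigma>' \<tau>' where "\<sigma>' = \<sigma>(l := \<tau> l)" and "\<tau>' = \<tau>(l := \<sigma> l)"
    have i': "\<sigma>' \<in> cells_on Q z (F i)" "\<tau>' \<in> cells_on Q z (F i)"
      using i cells_on_swap by (auto simp: \<sigma>'_def \<tau>'_def)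
    \<comment> \<open>A coordinate lies in both supports exactly when neither of the two entries is
      marginal, and an exchange of entries does not affect this. So both cells survive before the
      move iff both do after it; otherwise both sides are infinite.\<close>
    have "supp z \<sigma> \<inter> supp z \<tau> = supp z \<sigma>' \<inter> supp z \<tau>'"
      by (auto simp: supp_def \<sigma>'_def \<tau>'_def)
    then have "W (blk i) \<subseteq> supp z \<sigma> \<and> W (blk i) \<subseteq> supp z \<tau> \<longleftrightarrow>
        W (blk i) \<subseteq> supp z \<sigma>' \<and> W (blk i) \<subseteq> supp z \<tau>'"
      by (metis Int_subset_iff)
    then have KK: "K \<sigma> \<and> K \<tau> \<longleftrightarrow> K \<sigma>' \<and> K \<tau>'" using K_iff i i' by metis
    show "w B j b \<sigma> + w B j b \<tau> = w B j b (\<sigma>(l := \<tau> l)) + w B j b (\<tau>(l := \<sigma> l))"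
    proof (cases "K \<sigma> \<and> K \<tau>")
      case True
      then have K': "K \<sigma>' \<and> K \<tau>'" using KK by simp
      have "inB B \<sigma> \<longleftrightarrow> blk i = B" "inB B \<tau> \<longleftrightarrow> blk i = B"
        "inB B \<sigma>' \<longleftrightarrow> blk i = B" "inB B \<tau>' \<longleftrightarrow> blk i = B"
        using inB_iff i i' True K' by blast+
      then have "w B j b \<sigma> + w B j b \<tau> = w B j b \<sigma>' + w B j b \<tau>'"
        using True K' by (auto simp: w_def \<sigma>'_def \<tau>'_def)
      then show ?thesis by (simp only: \<sigma>'_def \<tau>'_def)
    next
      case False
      then have K': "\<not> (K \<sigma>' \<and> K \<tau>')" using KK by simp
      have "w B j b \<sigma> + w B j b \<tau> = \<infinity>" using False by (auto simp: w_def)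
      moreover have "w B j b \<sigma>' + w B j b \<tau>' = \<infinity>" using K' by (auto simp: w_def)
      ultimately show ?thesis by (simp only: \<sigma>'_def \<tau>'_def)
    qed
  qed
  have wtK: "weight (w B j b) x = enat (count (col (filter_mset (inB B) x) j) b)"
    if "\<And>\<sigma>. \<sigma> \<in># x \<Longrightarrow> K \<sigma>" for B j b x
  proof -
    have "weight (w B j b) x = weight (\<lambda>\<sigma>. if inB B \<sigma> \<and> \<sigma> j = b then 1 else 0) x"
      using that by (intro weight_cong) (auto simp: w_def)
    then show ?thesis by (simp add: weight_indicator count_col filter_filter_mset)
  qed
  have uK: "K \<sigma>" if "\<sigma> \<in># u" for \<sigma> using u[OF that] K_iff by blast
  have wts: "weight (w B j b) u = weight (w B j b) v" for B j b using weight_equiv inv by (simp add: weight_equiv_def)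
  have vK: "K \<sigma>" if "\<sigma> \<in># v" for \<sigma>
  proof (rule ccontr)
    assume "\<not> K \<sigma>"
    \<comment> \<open>Any indices serve here: all the weights \<open>w B j b\<close> are infinite on
      the same cells, and the weight of u is finite.\<close>
    then have "weight (w 0 0 0) v = \<infinity>" using that by (intro weight_eq_infinity) (auto simp: w_def)
    then show False using wts[of 0 0 0] wtK[of u 0 0 0] uK by simp
  qed
  show "W (blk i) \<subseteq> supp z \<sigma>" if "\<sigma> \<in># v" "i < 3" "\<sigma> \<in> cells_on Q z (F i)" for \<sigma> i
    using vK[OF that(1)] K_iff that by blast
  show "col (filter_mset (\<lambda>\<sigma>. \<exists>i<3. blk i = B \<and> \<sigma> \<in> cells_on Q z (F i)) u) j =
      col (filter_mset (\<lambda>\<sigma>. \<exists>i<3. blk i = B \<and> \<sigma> \<in> cells_on Q z (F i)) v) j" for B j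
    unfolding inB_def[symmetric]
    by (rule multiset_eqI) (use wts[of B j] wtK[OF uK] wtK[OF vK] in simp)
qed

section \<open>How the facets are linked in a class\<close>

definition pairs where
  "pairs Q z F u \<longleftrightarrow> (\<exists>u' c i k. swap_equiv Q z F u u' \<and> c \<in># u' \<and> i < 3 \<and> k < 3 \<and> i \<noteq> k \<and>
     c \<in> cells_on Q z (F i) \<and> c \<in> cells_on Q z (F k))"

text \<open>As in \<open>pairs\<close>, the cell has to occur only after some moves, which makes the
  notion a property of the class.\<close>

definition central where
  "central Q z F u \<longleftrightarrow> (\<exists>u' c. swap_equiv Q z F u u' \<and> c \<in># u' \<and> (\<forall>i<3. c \<in> cells_on Q z (F i)))"

definition on_faces where
  "on_faces Q z F u \<longleftrightarrow> (\<forall>\<sigma>\<in>#u. \<exists>i<3. \<sigma> \<in> cells_on Q z (F i))"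

lemma on_faces_swap_equiv: assumes "swap_equiv Q z F u v" "on_faces Q z F u" shows "on_faces Q z F v"
  using assms
proof (induction rule: rtranclp_induct)
  case (step a b)
  from step.hyps(2) step.IH[OF step.prems] show ?case
  proof cases
    case (1 i \<sigma> \<tau> M l)
    then have "\<sigma>(l := \<tau> l) \<in> cells_on Q z (F i)" "\<tau>(l := \<sigma> l) \<in> cells_on Q z (F i)"
      using cells_on_swap by blast+
    then show ?thesis using 1 step.IH[OF step.prems] by (auto simp: on_faces_def)
  qed
qed

lemma filter_union_disjoint:
  assumes "\<And>\<sigma>. \<sigma> \<in># u \<Longrightarrow> (P \<sigma> \<or> R \<sigma>) \<and> \<not> (P \<sigma> \<and> R \<sigma>)"
  shows "u = filter_mset P u + filter_mset R u"
proof -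
  have "filter_mset R u = filter_mset (\<lambda>\<sigma>. \<not> P \<sigma>) u"
    using assms by (intro filter_mset_cong) auto
  then show ?thesis by (simp add: multiset_partition[symmetric])
qed

text \<open>For an empty family the value is \<open>{e}\<close>, with e chosen outside of all facets.\<close>

definition common_supp where
  "common_supp z e A = (if A = {} then {e} else \<Inter>\<sigma>\<in>A. supp z \<sigma>)" for e :: nat

text \<open>If \<open>W i\<close> lay in another facet \<open>F k\<close>, gathering inside
  \<open>F i\<close> would create a cell common to both, that is, a pair. So each index can be its
  own block, and the weights give equal columns in each facet separately. Only u is assumed to be
  without pairs: the weights transfer the separation to v.\<close>

lemma swap_equiv_if_no_pairs:
  assumes fin: "\<And>i. i < 3 \<Longrightarrow> finite (F i)" and u: "on_faces Q z F u" and v: "on_faces Q z F v"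
    and np: "\<not> pairs Q z F u" and weight_equiv: "weight_equiv Q z F u v"
  shows "swap_equiv Q z F u v"
proof -
  have "finite (\<Union>i<3. F i)" by (intro finite_UN_I) (simp_all add: fin)
  then obtain e where e: "e \<notin> (\<Union>i<3. F i)" using ex_new_if_finite infinite_UNIV_nat by blast
  define W where "W i = common_supp z e {\<sigma>. \<sigma> \<in># u \<and> \<sigma> \<in> cells_on Q z (F i)}" for i
  have Wi: "W i \<subseteq> supp z \<sigma>" if "\<sigma> \<in># u" "\<sigma> \<in> cells_on Q z (F i)" for \<sigma> i
    using that by (auto simp: W_def common_supp_def)
  have sep: "\<not> W i \<subseteq> F k" if ik: "i < 3" "k < 3" "i \<noteq> k" for i k
  proof
    assume WF: "W i \<subseteq> F k"
    have "{\<sigma>. \<sigma> \<in># u \<and> \<sigma> \<in> cells_on Q z (F i)} \<noteq> {}"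
    proof
      assume "{\<sigma>. \<sigma> \<in># u \<and> \<sigma> \<in> cells_on Q z (F i)} = {}"
      then have "W i = {e}" unfolding W_def common_supp_def by simp
      then show False using WF e ik(2) by blast
    qed
    then obtain c where c: "c \<in># u" "c \<in> cells_on Q z (F i)" by blast
    obtain u' d where d: "swap_equiv Q z F u u'" "d \<in># u'" "d \<in> cells_on Q z (F i)"
      "\<forall>\<sigma>\<in>#u. \<sigma> \<in> cells_on Q z (F i) \<longrightarrow> supp z d \<subseteq> supp z \<sigma>"
      using gather[where F = F, OF ik(1) fin[OF ik(1)] c] by blast
    have "supp z d \<subseteq> W i" using d(4) c by (auto simp: W_def common_supp_def)
    then have "d \<in> cells_on Q z (F k)" using d(3) WF by (auto simp: cells_on_def)
    then show False using np d(1,2,3) ik unfolding pairs_def by blast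
  qed
  have uW: "\<exists>i<3. \<sigma> \<in> cells_on Q z (F i) \<and> W i \<subseteq> supp z \<sigma>" if "\<sigma> \<in># u" for \<sigma>
    using u that Wi unfolding on_faces_def by blast
  have vact: "\<exists>i<3. \<sigma> \<in> cells_on Q z (F i)" if "\<sigma> \<in># v" for \<sigma> using v that unfolding on_faces_def by blast
  have vW: "W i \<subseteq> supp z \<sigma>" if "\<sigma> \<in># v" "i < 3" "\<sigma> \<in> cells_on Q z (F i)" for \<sigma> i
    by (rule weight_equiv_blocks(1)[where blk = "\<lambda>i. i" and W = W, OF sep uW vact weight_equiv that])
  have cols: "col (filter_mset (\<lambda>\<sigma>. \<exists>i<3. i = B \<and> \<sigma> \<in> cells_on Q z (F i)) u) j =
      col (filter_mset (\<lambda>\<sigma>. \<exists>i<3. i = B \<and> \<sigma> \<in> cells_on Q z (F i)) v) j" for B j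
    by (rule weight_equiv_blocks(2)[where blk = "\<lambda>i. i" and W = W, OF sep uW vact weight_equiv])
  define f where "f i x = filter_mset (\<lambda>\<sigma>. \<sigma> \<in> cells_on Q z (F i)) x" for i x
  have split: "x = f 0 x + (f 1 x + f 2 x)"
    if x: "\<And>\<sigma>. \<sigma> \<in># x \<Longrightarrow> \<exists>i<3. \<sigma> \<in> cells_on Q z (F i)"
      "\<And>\<sigma> i. \<sigma> \<in># x \<Longrightarrow> i < 3 \<Longrightarrow> \<sigma> \<in> cells_on Q z (F i) \<Longrightarrow> W i \<subseteq> supp z \<sigma>" for x
  proof -
    have disj: "\<not> (\<sigma> \<in> cells_on Q z (F i) \<and> \<sigma> \<in> cells_on Q z (F k))" if "\<sigma> \<in># x" "i < 3" "k < 3" "i \<noteq> k" for \<sigma> i k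
      using sep[OF that(2-4)] x(2)[OF that(1,2)] by (auto simp: cells_on_def)
    have ex: "\<sigma> \<in> cells_on Q z (F 0) \<or> \<sigma> \<in> cells_on Q z (F 1) \<or> \<sigma> \<in> cells_on Q z (F 2)" if "\<sigma> \<in># x" for \<sigma>
      using x(1)[OF that] by (auto simp: less_3_iff)
    define r where "r = filter_mset (\<lambda>\<sigma>. \<sigma> \<in> cells_on Q z (F 1) \<or> \<sigma> \<in> cells_on Q z (F 2)) x"
    have "x = f 0 x + r"
      unfolding f_def r_def
      by (rule filter_union_disjoint)
        (use ex disj[of _ 0 1] disj[of _ 0 2] in auto)
    moreover have "r = f 1 r + f 2 r"
      unfolding f_def
      by (rule filter_union_disjoint) (use disj[of _ 1 2] in \<open>auto simp: r_def\<close>)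
    moreover have "f 1 r = f 1 x" "f 2 r = f 2 x"
      unfolding f_def r_def filter_filter_mset by (auto intro!: filter_mset_cong)
    ultimately show ?thesis by simp
  qed
  have c: "swap_equiv Q z F (f i u) (f i v)" if "i < 3" for i
  proof (rule swap_equiv_single[where F = F and i = i, OF that fin[OF that]])
    show "col (f i u) j = col (f i v) j" for j
      using cols[of i j] that unfolding f_def by (simp add: conj_commute)
  qed (auto simp: f_def)
  have "swap_equiv Q z F (f 0 u + (f 1 u + f 2 u)) (f 0 v + (f 1 v + f 2 v))"
    by (intro swap_equiv_add c) simp_all
  moreover have "u = f 0 u + (f 1 u + f 2 u)"
    by (rule split) (use u Wi in \<open>auto simp: on_faces_def\<close>)
  moreover have "v = f 0 v + (f 1 v + f 2 v)"
    by (rule split[OF vact vW])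
  ultimately show ?thesis by simp
qed


text \<open>The linked facets i and k form one block and m forms another. If the blocks were not
  separated, gathering would produce a cell common to all three facets. Within the block of i and k,
  cells common to both facets serve as hubs.\<close>

lemma swap_equiv_if_pair:
  assumes fin: "\<And>i. i < 3 \<Longrightarrow> finite (F i)" and u: "on_faces Q z F u" and v: "on_faces Q z F v"
    and ik: "i < 3" "k < 3" "i \<noteq> k" and c: "c \<in># u" "c \<in> cells_on Q z (F i)" "c \<in> cells_on Q z (F k)"
    and nc: "\<not> central Q z F u" and pv: "pairs Q z F v" and weight_equiv: "weight_equiv Q z F u v"
  shows "swap_equiv Q z F u v"
proof -
  obtain m where m: "m < 3" "m \<noteq> i" "m \<noteq> k" "\<And>r. r < 3 \<Longrightarrow> r = i \<or> r = k \<or> r = m"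
    using third_index[OF ik] by blast
  have centralI: False
    if "swap_equiv Q z F u u'" "d \<in># u'" "d \<in> cells_on Q z (F i)" "d \<in> cells_on Q z (F k)" "d \<in> cells_on Q z (F m)" for u' d
    using nc that m(4) unfolding central_def by metis
  have cm: "c \<notin> cells_on Q z (F m)" using centralI[OF rtranclp.rtrancl_refl c] by blast
  have "finite (\<Union>i<3. F i)" by (intro finite_UN_I) (simp_all add: fin)
  then obtain e where e: "e \<notin> (\<Union>i<3. F i)" using ex_new_if_finite infinite_UNIV_nat by blast
  define blk where "blk r = (if r = m then m else i)" for r
  define W where "W B = common_supp z e {\<sigma>. \<sigma> \<in># u \<and> (\<exists>r<3. blk r = B \<and> \<sigma> \<in> cells_on Q z (F r))}" for B
  have blk: "blk i = i" "blk k = i" "blk m = m" using m by (auto simp: blk_def)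
  have bi: "(\<exists>r<3. blk r = i \<and> P r) \<longleftrightarrow> P i \<or> P k" and bm: "(\<exists>r<3. blk r = m \<and> P r) \<longleftrightarrow> P m" for P
    using m ik blk by metis+
  have W_sub: "W (blk r) \<subseteq> supp z \<sigma>" if "\<sigma> \<in># u" "r < 3" "\<sigma> \<in> cells_on Q z (F r)" for \<sigma> r
  proof -
    have "\<sigma> \<in> {\<sigma>. \<sigma> \<in># u \<and> (\<exists>r'<3. blk r' = blk r \<and> \<sigma> \<in> cells_on Q z (F r'))}" using that by blast
    then show ?thesis unfolding W_def common_supp_def by auto
  qed
  have Wi: "\<not> W i \<subseteq> F m"
  proof
    assume WF: "W i \<subseteq> F m"
    \<comment> \<open>Two gatherings, in \<open>F i\<close> and then in \<open>F k\<close>. The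
      first cell has support inside that of c, hence lies in \<open>F k\<close> as well and takes
      part in the second. The final support lies inside that of every cell of u in either facet,
      since cells outside \<open>F i\<close> survive the first gathering.\<close>
    obtain u1 c1 where c1: "swap_equiv Q z F u u1" "c1 \<in># u1" "c1 \<in> cells_on Q z (F i)"
      "\<forall>\<sigma>\<in>#u. \<sigma> \<in> cells_on Q z (F i) \<longrightarrow> supp z c1 \<subseteq> supp z \<sigma>"
      "\<forall>\<sigma>\<in>#u. \<sigma> \<notin> cells_on Q z (F i) \<longrightarrow> \<sigma> \<in># u1"
      using gather[where F = F, OF ik(1) fin[OF ik(1)] c(1,2)] by blast
    have "supp z c1 \<subseteq> supp z c" using c1(4) c by blast
    then have c1k: "c1 \<in> cells_on Q z (F k)" using c1(3) c(3) by (auto simp: cells_on_def)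
    obtain u2 c2 where c2: "swap_equiv Q z F u1 u2" "c2 \<in># u2" "c2 \<in> cells_on Q z (F k)"
      "\<forall>\<sigma>\<in>#u1. \<sigma> \<in> cells_on Q z (F k) \<longrightarrow> supp z c2 \<subseteq> supp z \<sigma>"
      using gather[where F = F, OF ik(2) fin[OF ik(2)] c1(2) c1k] by blast
    have c21: "supp z c2 \<subseteq> supp z c1" using c2(4) c1(2) c1k by blast
    have "supp z c2 \<subseteq> supp z \<sigma>" if "\<sigma> \<in># u" "\<sigma> \<in> cells_on Q z (F i) \<or> \<sigma> \<in> cells_on Q z (F k)" for \<sigma>
    proof (cases "\<sigma> \<in> cells_on Q z (F i)")
      case True
      then show ?thesis using c21 c1(4) that(1) by blast
    next
      case False
      then show ?thesis using c2(4) c1(5) that by blast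
    qed
    then have "supp z c2 \<subseteq> W i"
      using c unfolding W_def common_supp_def bi by auto
    then have "c2 \<in> cells_on Q z (F m)" "c2 \<in> cells_on Q z (F i)"
      using WF c2(3) c21 c1(3) by (auto simp: cells_on_def)
    then show False using centralI[OF rtranclp_trans[OF c1(1) c2(1)] c2(2) _ c2(3)] by blast
  qed
  have Wm: "\<not> W m \<subseteq> F r" if r: "r = i \<or> r = k" for r
  proof
    assume WF: "W m \<subseteq> F r"
    have r3: "r < 3" and cr: "c \<in> cells_on Q z (F r)" using r ik c by auto
    have "{\<sigma>. \<sigma> \<in># u \<and> \<sigma> \<in> cells_on Q z (F m)} \<noteq> {}"
    proof
      assume "{\<sigma>. \<sigma> \<in># u \<and> \<sigma> \<in> cells_on Q z (F m)} = {}"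
      then have "W m = {e}" unfolding W_def common_supp_def bm by simp
      then show False using WF e r3 by blast
    qed
    then obtain d where d: "d \<in># u" "d \<in> cells_on Q z (F m)" by blast
    \<comment> \<open>The cell gathered in \<open>F m\<close> lies in \<open>F r\<close> too, and c
      is still present because it is not in \<open>F m\<close>. A second gathering in
      \<open>F r\<close> pushes the support into that of c and that of \<open>c1\<close>, hence into
      all three facets.\<close>
    obtain u1 c1 where c1: "swap_equiv Q z F u u1" "c1 \<in># u1" "c1 \<in> cells_on Q z (F m)"
      "\<forall>\<sigma>\<in>#u. \<sigma> \<in> cells_on Q z (F m) \<longrightarrow> supp z c1 \<subseteq> supp z \<sigma>"
      "\<forall>\<sigma>\<in>#u. \<sigma> \<notin> cells_on Q z (F m) \<longrightarrow> \<sigma> \<in># u1"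
      using gather[where F = F, OF m(1) fin[OF m(1)] d] by blast
    have "supp z c1 \<subseteq> W m" using c1(4) d unfolding W_def common_supp_def bm by auto
    then have c1r: "c1 \<in> cells_on Q z (F r)" using c1(3) WF by (auto simp: cells_on_def)
    have "c \<in># u1" using c1(5) c(1) cm by blast
    obtain u2 c2 where c2: "swap_equiv Q z F u1 u2" "c2 \<in># u2" "c2 \<in> cells_on Q z (F r)"
      "\<forall>\<sigma>\<in>#u1. \<sigma> \<in> cells_on Q z (F r) \<longrightarrow> supp z c2 \<subseteq> supp z \<sigma>"
      using gather[where F = F, OF r3 fin[OF r3] c1(2) c1r] by blast
    have "supp z c2 \<subseteq> supp z c" "supp z c2 \<subseteq> supp z c1"
      using c2(4) \<open>c \<in># u1\<close> cr c1(2) c1r by blast+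
    then have "c2 \<in> cells_on Q z (F i)" "c2 \<in> cells_on Q z (F k)" "c2 \<in> cells_on Q z (F m)"
      using c2(3) c c1(3) by (auto simp: cells_on_def)
    then show False using centralI[OF rtranclp_trans[OF c1(1) c2(1)] c2(2)] by blast
  qed
  have sep: "\<not> W (blk r) \<subseteq> F s" if "r < 3" "s < 3" "blk r \<noteq> blk s" for r s
  proof (cases "r = m")
    case True
    then have "s = i \<or> s = k" using that m(4)[of s] by auto
    then show ?thesis using Wm True blk by simp
  next
    case False
    then have "s = m" "blk r = i" using that by (auto simp: blk_def split: if_splits)
    then show ?thesis using Wi by simp
  qed
  have uW: "\<exists>r<3. \<sigma> \<in> cells_on Q z (F r) \<and> W (blk r) \<subseteq> supp z \<sigma>" if "\<sigma> \<in># u" for \<sigma>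
    using u that W_sub unfolding on_faces_def by blast
  obtain v' d p q where d: "swap_equiv Q z F v v'" "d \<in># v'" "p < 3" "q < 3" "p \<noteq> q"
    "d \<in> cells_on Q z (F p)" "d \<in> cells_on Q z (F q)"
    using pv unfolding pairs_def by blast
  have v': "on_faces Q z F v'" using on_faces_swap_equiv[OF d(1) v] .
  have weight_equiv': "weight_equiv Q z F u v'" by (rule weight_equiv_swap_equiv[OF weight_equiv rtranclp.rtrancl_refl d(1)])
  have vact: "\<exists>r<3. \<sigma> \<in> cells_on Q z (F r)" if "\<sigma> \<in># v'" for \<sigma> using v' that unfolding on_faces_def by blast
  have vW: "W (blk r) \<subseteq> supp z \<sigma>" if "\<sigma> \<in># v'" "r < 3" "\<sigma> \<in> cells_on Q z (F r)" for \<sigma> r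
    by (rule weight_equiv_blocks(1)[where blk = blk and W = W, OF sep uW vact weight_equiv' that])
  have cols: "col (filter_mset (\<lambda>\<sigma>. \<exists>r<3. blk r = B \<and> \<sigma> \<in> cells_on Q z (F r)) u) j =
      col (filter_mset (\<lambda>\<sigma>. \<exists>r<3. blk r = B \<and> \<sigma> \<in> cells_on Q z (F r)) v') j" for B j
    by (rule weight_equiv_blocks(2)[where blk = blk and W = W, OF sep uW vact weight_equiv'])
  have disj: "\<not> (\<sigma> \<in> cells_on Q z (F r) \<and> \<sigma> \<in> cells_on Q z (F s))"
    if "W (blk r) \<subseteq> supp z \<sigma>" "r < 3" "s < 3" "blk r \<noteq> blk s" for \<sigma> r s
    using sep[OF that(2-4)] that(1) by (auto simp: cells_on_def)
  \<comment> \<open>A cell of \<open>v'\<close> cannot lie in facets of two blocks, so the pair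
    found in \<open>v'\<close>, a priori at any two indices, is at i and k.\<close>
  have "blk p = blk q" using disj[OF vW[OF d(2,3,6)] d(3,4)] d(6,7) by blast
  then have "p \<noteq> m \<and> q \<noteq> m" using d(5) m by (auto simp: blk_def split: if_splits)
  then have di: "d \<in> cells_on Q z (F i)" "d \<in> cells_on Q z (F k)" using d(3-7) m(4)[of p] m(4)[of q] by auto
  define f where "f x = filter_mset (\<lambda>\<sigma>. \<sigma> \<in> cells_on Q z (F i) \<or> \<sigma> \<in> cells_on Q z (F k)) x" for x
  define g where "g x = filter_mset (\<lambda>\<sigma>. \<sigma> \<in> cells_on Q z (F m)) x" for x
  have split: "x = f x + g x"
    if x: "\<And>\<sigma>. \<sigma> \<in># x \<Longrightarrow> \<exists>r<3. \<sigma> \<in> cells_on Q z (F r)"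
      "\<And>\<sigma> r. \<sigma> \<in># x \<Longrightarrow> r < 3 \<Longrightarrow> \<sigma> \<in> cells_on Q z (F r) \<Longrightarrow> W (blk r) \<subseteq> supp z \<sigma>" for x
    unfolding f_def g_def
  proof (rule filter_union_disjoint)
    fix \<sigma> assume s: "\<sigma> \<in># x"
    have "blk i \<noteq> blk m" "blk k \<noteq> blk m" using blk m by auto
    then have "\<not> (\<sigma> \<in> cells_on Q z (F i) \<and> \<sigma> \<in> cells_on Q z (F m))" "\<not> (\<sigma> \<in> cells_on Q z (F k) \<and> \<sigma> \<in> cells_on Q z (F m))"
      using disj[of i \<sigma> m] disj[of k \<sigma> m] x(2)[OF s] ik m(1) by blast+
    moreover have "\<sigma> \<in> cells_on Q z (F i) \<or> \<sigma> \<in> cells_on Q z (F k) \<or> \<sigma> \<in> cells_on Q z (F m)"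
      using x(1)[OF s] m(4) by blast
    ultimately show "((\<sigma> \<in> cells_on Q z (F i) \<or> \<sigma> \<in> cells_on Q z (F k)) \<or> \<sigma> \<in> cells_on Q z (F m)) \<and>
        \<not> ((\<sigma> \<in> cells_on Q z (F i) \<or> \<sigma> \<in> cells_on Q z (F k)) \<and> \<sigma> \<in> cells_on Q z (F m))" by blast
  qed
  have "swap_equiv Q z F (g u) (g v')"
  proof (rule swap_equiv_single[where F = F and i = m, OF m(1) fin[OF m(1)]])
    show "col (g u) j = col (g v') j" for j using cols[of m j] unfolding g_def bm .
  qed (auto simp: g_def)
  moreover have "swap_equiv Q z F (f u) (f v')"
  proof -
    \<comment> \<open>The third facet is replaced by a copy of \<open>F i\<close>, so that c and d
      become common to all three members of the family.\<close>
    have "swap_equiv Q z (F(m := F i)) (f u) (f v')"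
    proof (rule swap_equiv_central)
      show "c \<in># f u" "d \<in># f v'" using c d(2) di by (auto simp: f_def)
      show "col (f u) j = col (f v') j" for j using cols[of i j] unfolding f_def bi .
      show "finite ((F(m := F i)) r)" if "r < 3" for r using fin that ik by simp
      show "c \<in> cells_on Q z ((F(m := F i)) r)" "d \<in> cells_on Q z ((F(m := F i)) r)" if "r < 3" for r
        using m(4)[OF that] c di by auto
      show "\<exists>r<3. \<sigma> \<in> cells_on Q z ((F(m := F i)) r)" if "\<sigma> \<in># f u" for \<sigma>
        using that ik m(2,3) by (auto simp: f_def)
      show "\<exists>r<3. \<sigma> \<in> cells_on Q z ((F(m := F i)) r)" if "\<sigma> \<in># f v'" for \<sigma>
        using that ik m(2,3) by (auto simp: f_def)
    qed
    then show ?thesis by (rule swap_equiv_mono) (use ik in \<open>auto split: if_splits\<close>)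
  qed
  ultimately have "swap_equiv Q z F (f u + g u) (f v' + g v')" by (intro swap_equiv_add)
  moreover have "u = f u + g u"
    by (rule split) (use u W_sub in \<open>auto simp: on_faces_def\<close>)
  moreover have "v' = f v' + g v'" by (rule split[OF vact vW])
  ultimately have "swap_equiv Q z F u v'" by simp
  then show ?thesis using swap_equiv_sym[OF d(1)] by (rule rtranclp_trans)
qed

lemma swap_equiv_if_pairs_not_central:
  assumes fin: "\<And>i. i < 3 \<Longrightarrow> finite (F i)" and u: "on_faces Q z F u" and v: "on_faces Q z F v"
    and pu: "pairs Q z F u" and nc: "\<not> central Q z F u" and pv: "pairs Q z F v" and weight_equiv: "weight_equiv Q z F u v"
  shows "swap_equiv Q z F u v"
proof -
  obtain u' c i k where c: "swap_equiv Q z F u u'" "c \<in># u'" "i < 3" "k < 3" "i \<noteq> k"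
    "c \<in> cells_on Q z (F i)" "c \<in> cells_on Q z (F k)"
    using pu unfolding pairs_def by blast
  have nc': "\<not> central Q z F u'"
    using nc rtranclp_trans[OF c(1)] unfolding central_def by blast
  have "swap_equiv Q z F u' v"
    by (rule swap_equiv_if_pair[where F = F and i = i and k = k, OF fin on_faces_swap_equiv[OF c(1) u] v c(3-5) c(2,6,7) nc' pv
        weight_equiv_swap_equiv[OF weight_equiv c(1) rtranclp.rtrancl_refl]])
  then show ?thesis by (rule rtranclp_trans[OF c(1)])
qed

text \<open>Each of the case lemmas assumes the failure of \<open>pairs\<close> or
  \<open>central\<close> for one side only. By symmetry the remaining case has the property on both
  sides, so no weight has to detect these notions directly.\<close>

lemma swap_equiv_if_weight_equiv_on_faces:
  assumes fin: "\<And>i. i < 3 \<Longrightarrow> finite (F i)" and u: "on_faces Q z F u" and v: "on_faces Q z F v"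
    and weight_equiv: "weight_equiv Q z F u v"
  shows "swap_equiv Q z F u v"
proof (cases "pairs Q z F u \<and> pairs Q z F v")
  case False
  then show ?thesis
    using swap_equiv_if_no_pairs[where F = F, OF fin u v _ weight_equiv]
      swap_equiv_sym[OF swap_equiv_if_no_pairs[where F = F, OF fin v u _ weight_equiv_sym[OF weight_equiv]]] by blast
next
  case pp: True
  show ?thesis
  proof (cases "central Q z F u \<and> central Q z F v")
    case False
    then show ?thesis
      using swap_equiv_if_pairs_not_central[where F = F, OF fin u v _ _ _ weight_equiv]
        swap_equiv_sym[OF swap_equiv_if_pairs_not_central[where F = F, OF fin v u _ _ _ weight_equiv_sym[OF weight_equiv]]] pp by blast
  next
    case True
    then obtain u' c v' d where c: "swap_equiv Q z F u u'" "c \<in># u'" "\<forall>i<3. c \<in> cells_on Q z (F i)"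
      and d: "swap_equiv Q z F v v'" "d \<in># v'" "\<forall>i<3. d \<in> cells_on Q z (F i)"
      unfolding central_def by blast
    have "on_faces Q z F u'" "on_faces Q z F v'" using on_faces_swap_equiv c(1) d(1) u v by blast+
    then have "swap_equiv Q z F u' v'"
      using swap_equiv_central[where F = F, OF fin _ _ c(2) _ d(2) _ weight_equiv_col[OF weight_equiv_swap_equiv[OF weight_equiv c(1) d(1)]]]
        c(3) d(3) unfolding on_faces_def by blast
    then show ?thesis using c(1) swap_equiv_sym[OF d(1)] by (meson rtranclp_trans)
  qed
qed

text \<open>A cell outside all facets never takes part in a proper exchange within a facet, so its
  multiplicity is an invariant weight. An invariant weight stays invariant when reset to 0 off the
  facets, which splits off the remaining cells.\<close>

lemma swap_equiv_if_weight_equiv: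
  assumes fin: "\<And>i. i < 3 \<Longrightarrow> finite (F i)" and weight_equiv: "weight_equiv Q z F u v"
  shows "swap_equiv Q z F u v"
proof -
  define P where "P \<sigma> \<longleftrightarrow> (\<exists>i<3. \<sigma> \<in> cells_on Q z (F i))" for \<sigma>
  have P: "P \<sigma>" if "\<sigma> \<in> cells_on Q z (F i)" "i < 3" for \<sigma> i using that by (auto simp: P_def)
  have "filter_mset (\<lambda>\<sigma>. \<not> P \<sigma>) u = filter_mset (\<lambda>\<sigma>. \<not> P \<sigma>) v"
  proof (rule multiset_eqI)
    fix \<rho>
    show "count (filter_mset (\<lambda>\<sigma>. \<not> P \<sigma>) u) \<rho> = count (filter_mset (\<lambda>\<sigma>. \<not> P \<sigma>) v) \<rho>"
    proof (cases "P \<rho>")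
      case False
      have "inv_weight Q z F (\<lambda>\<sigma>. if \<sigma> = \<rho> then 1 else 0)"
        unfolding inv_weight_def
      proof (intro allI impI ballI)
        fix i \<sigma> \<tau> l assume i: "i < (3::nat)" "\<sigma> \<in> cells_on Q z (F i)" "\<tau> \<in> cells_on Q z (F i)"
        have "\<sigma> \<noteq> \<rho>" "\<tau> \<noteq> \<rho>" "\<sigma>(l := \<tau> l) \<noteq> \<rho>" "\<tau>(l := \<sigma> l) \<noteq> \<rho>"
          using False P[OF i(2,1)] P[OF i(3,1)] P[OF cells_on_swap[OF i(2,3)] i(1)] P[OF cells_on_swap[OF i(3,2)] i(1)]
          by metis+
        then show "(if \<sigma> = \<rho> then 1 else 0) + (if \<tau> = \<rho> then 1 else 0) =
          (if \<sigma>(l := \<tau> l) = \<rho> then 1 else 0) + (if \<tau>(l := \<sigma> l) = \<rho> then 1 else (0::enat))" by simp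
      qed
      then have "weight (\<lambda>\<sigma>. if \<sigma> = \<rho> then 1 else 0) u = weight (\<lambda>\<sigma>. if \<sigma> = \<rho> then 1 else 0) v"
        using weight_equiv by (simp add: weight_equiv_def)
      then have "count u \<rho> = count v \<rho>"
        by (simp add: weight_indicator filter_eq_replicate_mset)
      then show ?thesis by simp
    qed simp
  qed
  moreover have "swap_equiv Q z F (filter_mset P u) (filter_mset P v)"
  proof (rule swap_equiv_if_weight_equiv_on_faces[where F = F, OF fin])
    show "weight_equiv Q z F (filter_mset P u) (filter_mset P v)"
      unfolding weight_equiv_def
    proof (intro allI impI)
      fix w assume w: "inv_weight Q z F w"
      define w' where "w' \<sigma> = (if P \<sigma> then w \<sigma> else 0)" for \<sigma>
      have "inv_weight Q z F w'"
        unfolding inv_weight_def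
      proof (intro allI impI ballI)
        fix i \<sigma> \<tau> l assume i: "i < (3::nat)" "\<sigma> \<in> cells_on Q z (F i)" "\<tau> \<in> cells_on Q z (F i)"
        have "w \<sigma> + w \<tau> = w (\<sigma>(l := \<tau> l)) + w (\<tau>(l := \<sigma> l))" using w i unfolding inv_weight_def by blast
        then show "w' \<sigma> + w' \<tau> = w' (\<sigma>(l := \<tau> l)) + w' (\<tau>(l := \<sigma> l))"
          using P[OF i(2,1)] P[OF i(3,1)] P[OF cells_on_swap[OF i(2,3)] i(1)] P[OF cells_on_swap[OF i(3,2)] i(1)]
          by (simp add: w'_def)
      qed
      then have "weight w' u = weight w' v" using weight_equiv by (simp add: weight_equiv_def)
      moreover have "weight w' x = weight w (filter_mset P x)" for x
        by (induction x) (auto simp: w'_def)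
      ultimately show "weight w (filter_mset P u) = weight w (filter_mset P v)" by simp
    qed
  qed (auto simp: on_faces_def P_def)
  ultimately have "swap_equiv Q z F (filter_mset P u + filter_mset (\<lambda>\<sigma>. \<not> P \<sigma>) u)
      (filter_mset P v + filter_mset (\<lambda>\<sigma>. \<not> P \<sigma>) v)"
    using swap_equiv_add_right by metis
  then show ?thesis by (simp only: multiset_partition[symmetric])
qed

section \<open>Isolating one class by a weight\<close>

lemma inv_weight_combine:
  assumes "inv_weight Q z F w" "inv_weight Q z F w'"
  shows "inv_weight Q z F (\<lambda>\<sigma>. enat B * w \<sigma> + w' \<sigma>)"
  unfolding inv_weight_def
proof (intro allI impI ballI)
  fix i \<sigma> \<tau> l assume i: "i < (3::nat)" "\<sigma> \<in> cells_on Q z (F i)" "\<tau> \<in> cells_on Q z (F i)"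
  have "w \<sigma> + w \<tau> = w (\<sigma>(l := \<tau> l)) + w (\<tau>(l := \<sigma> l))"
    "w' \<sigma> + w' \<tau> = w' (\<sigma>(l := \<tau> l)) + w' (\<tau>(l := \<sigma> l))"
    using assms i unfolding inv_weight_def by blast+
  then have "enat B * (w \<sigma> + w \<tau>) + (w' \<sigma> + w' \<tau>) =
      enat B * (w (\<sigma>(l := \<tau> l)) + w (\<tau>(l := \<sigma> l))) + (w' (\<sigma>(l := \<tau> l)) + w' (\<tau>(l := \<sigma> l)))"
    by simp
  then show "enat B * w \<sigma> + w' \<sigma> + (enat B * w \<tau> + w' \<tau>) =
    enat B * w (\<sigma>(l := \<tau> l)) + w' (\<sigma>(l := \<tau> l)) + (enat B * w (\<tau>(l := \<sigma> l)) + w' (\<tau>(l := \<sigma> l)))"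
    by (simp add: algebra_simps)
qed

lemma weight_combine: "weight (\<lambda>\<sigma>. enat B * w \<sigma> + w' \<sigma>) u = enat B * weight w u + weight w' u"
  by (induction u) (auto simp: algebra_simps)

text \<open>One element is added at a time. If the isolated u ties with the new x, a weight telling
  them apart is appended as a lower digit, in a base so large that earlier distinctions
  persist.\<close>

lemma exists_isolating_weight:
  assumes "finite U" "U \<noteq> {}"
    and "\<And>u v. u \<in> U \<Longrightarrow> v \<in> U \<Longrightarrow> u \<noteq> v \<Longrightarrow> \<not> weight_equiv Q z F u v"
  shows "\<exists>w u. inv_weight Q z F w \<and> u \<in> U \<and> weight w u \<noteq> \<infinity> \<and> (\<forall>v\<in>U. v \<noteq> u \<longrightarrow> weight w v \<noteq> weight w u)"
  using assms
proof (induction U rule: finite_ne_induct)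
  case (singleton u)
  have "inv_weight Q z F (\<lambda>_. 0)" by (simp add: inv_weight_def)
  moreover have "weight (\<lambda>_. 0) u = 0" by (simp add: weight_def)
  ultimately show ?case by (intro exI[of _ "\<lambda>_. 0"] exI[of _ u]) simp
next
  case (insert x U)
  obtain w u where w: "inv_weight Q z F w" "u \<in> U" "weight w u \<noteq> \<infinity>"
    and wu: "\<And>v. v \<in> U \<Longrightarrow> v \<noteq> u \<Longrightarrow> weight w v \<noteq> weight w u"
    using insert.IH insert.prems by (metis insertCI)
  show ?case
  proof (cases "weight w x = weight w u")
    case False
    then show ?thesis using w wu by (intro exI[of _ w] exI[of _ u]) auto
  next
    case eq: True
    have "u \<noteq> x" using w insert.hyps by blast
    then obtain w' where w': "inv_weight Q z F w'" "weight w' u \<noteq> weight w' x"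
      using insert.prems[of u x] w(2) unfolding weight_equiv_def by blast
    \<comment> \<open>The two weights differ, so at least one is finite. It may be that of x, so the
      isolated element can change.\<close>
    obtain y where y: "y = u \<or> y = x" "weight w' y \<noteq> \<infinity>" using w'(2) by metis
    obtain N where N: "weight w y = enat N" using w(3) eq y(1) by auto
    obtain N' where N': "weight w' y = enat N'" using y(2) by auto
    \<comment> \<open>The base exceeds all finite values of \<open>w'\<close> on U and at y, so
      weights are compared like two-digit numbers. It is positive, as 0 times infinity is 0 and
      would lose the infinite values of w.\<close>
    define B where "B = Suc (N' + (\<Sum>v\<in>U. the_enat (weight w' v)))"
    define W where "W = (\<lambda>\<sigma>. enat B * w \<sigma> + w' \<sigma>)"
    have Wy: "weight W y = enat (B * N + N')" by (simp add: W_def weight_combine N N')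
    have "weight W v \<noteq> weight W y" if v: "v \<in> insert x U" "v \<noteq> y" for v
    proof (cases "v = u \<or> v = x")
      case True
      then have "weight w v = enat N" "weight w' v \<noteq> enat N'" using eq N N' w'(2) y(1) v(2) by auto
      then show ?thesis unfolding Wy by (cases "weight w' v") (auto simp: W_def weight_combine)
    next
      case False
      then have vU: "v \<in> U" using v by simp
      then have ne: "weight w v \<noteq> enat N" using wu False eq N y(1) by metis
      show ?thesis
      proof (cases "weight w v = \<infinity> \<or> weight w' v = \<infinity>")
        case True
        then have "weight W v = \<infinity>" by (auto simp: W_def weight_combine B_def zero_enat_def imult_is_infinity)
        then show ?thesis by (simp add: Wy)
      next
        case False
        then obtain M M' where M: "weight w v = enat M" "weight w' v = enat M'" by auto
        have "M' \<le> (\<Sum>v\<in>U. the_enat (weight w' v))"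
          using member_le_sum[OF vU, of "\<lambda>v. the_enat (weight w' v)"] insert.hyps(1) M by simp
        then have lt: "M' < B" "N' < B" by (auto simp: B_def)
        have "M \<noteq> N" using ne M by simp
        moreover have "M = N" if "B * M + M' = B * N + N'"
        proof -
          have "(B * M + M') div B = M" "(B * N + N') div B = N" using lt by auto
          then show ?thesis using that by simp
        qed
        ultimately show ?thesis unfolding Wy by (auto simp: W_def weight_combine M)
      qed
    qed
    moreover have "inv_weight Q z F W" unfolding W_def by (rule inv_weight_combine[OF w(1) w'(1)])
    moreover have "y \<in> insert x U" using y(1) w(2) by auto
    ultimately show ?thesis using Wy by (intro exI[of _ W] exI[of _ y]) auto
  qed
qed

section \<open>Evaluation of polynomials and ideals\<close>

lemma poly_mapping_sum_induct [case_names zero single add]: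
  assumes "P 0" "\<And>k c. P (Poly_Mapping.single k c)" "\<And>f g. P f \<Longrightarrow> P g \<Longrightarrow> P (f + g)"
  shows "P (f :: 'a \<Rightarrow>\<^sub>0 'b::monoid_add)"
proof (induction f rule: update_induct)
  case (update f a b)
  have "Poly_Mapping.update a b f = Poly_Mapping.single a b + f"
    using update.hyps(1)
    by (intro poly_mapping_eqI) (auto simp: lookup_update lookup_add lookup_single in_keys_iff when_def)
  then show ?case using assms(2,3) update.IH by simp
qed (rule assms(1))

definition eval_mon :: "('v \<Rightarrow> 'b::comm_ring_1) \<Rightarrow> ('v \<Rightarrow>\<^sub>0 nat) \<Rightarrow> 'b" where
  "eval_mon q m = (\<Prod>v\<in>Poly_Mapping.keys m. q v ^ Poly_Mapping.lookup m v)"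

definition eval_tpoly :: "((nat \<Rightarrow> nat) \<Rightarrow> 'k::field poly) \<Rightarrow> 'k tpoly \<Rightarrow> 'k poly" where
  "eval_tpoly q f = (\<Sum>m\<in>Poly_Mapping.keys f. [:Poly_Mapping.lookup f m:] * eval_mon q m)"

lemma eval_mon_superset:
  assumes "finite S" "Poly_Mapping.keys m \<subseteq> S" shows "eval_mon q m = (\<Prod>v\<in>S. q v ^ Poly_Mapping.lookup m v)"
  unfolding eval_mon_def by (rule prod.mono_neutral_left) (use assms in \<open>auto simp: in_keys_iff\<close>)

lemma eval_mon_add: "eval_mon q (m + m') = eval_mon q m * eval_mon q m'"
proof -
  define S where "S = Poly_Mapping.keys m \<union> Poly_Mapping.keys m'"
  have S: "finite S" "Poly_Mapping.keys m \<subseteq> S" "Poly_Mapping.keys m' \<subseteq> S" "Poly_Mapping.keys (m + m') \<subseteq> S"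
    using Poly_Mapping.keys_add[of m m'] by (auto simp: S_def)
  show ?thesis
    by (simp add: eval_mon_superset[OF S(1)] S lookup_add power_add prod.distrib)
qed

lemma eval_tpoly_superset:
  assumes "finite S" "Poly_Mapping.keys f \<subseteq> S" shows "eval_tpoly q f = (\<Sum>m\<in>S. [:Poly_Mapping.lookup f m:] * eval_mon q m)"
  unfolding eval_tpoly_def by (rule sum.mono_neutral_left) (use assms in \<open>auto simp: in_keys_iff\<close>)

lemma eval_tpoly_add: "eval_tpoly q (f + g) = eval_tpoly q f + eval_tpoly q g"
proof -
  define S where "S = Poly_Mapping.keys f \<union> Poly_Mapping.keys g"
  have S: "finite S" "Poly_Mapping.keys f \<subseteq> S" "Poly_Mapping.keys g \<subseteq> S" "Poly_Mapping.keys (f + g) \<subseteq> S"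
    using Poly_Mapping.keys_add[of f g] by (auto simp: S_def)
  have "[:Poly_Mapping.lookup (f + g) m:] = [:Poly_Mapping.lookup f m:] + [:Poly_Mapping.lookup g m:]" for m by (simp add: lookup_add)
  then show ?thesis
    by (simp only: eval_tpoly_superset[OF S(1) S(2)] eval_tpoly_superset[OF S(1) S(3)]
        eval_tpoly_superset[OF S(1) S(4)] distrib_right sum.distrib)
qed

lemma eval_tpoly_zero: "eval_tpoly q 0 = 0"
  by (simp add: eval_tpoly_def)

lemma eval_tpoly_single: "eval_tpoly q (Poly_Mapping.single m c) = [:c:] * eval_mon q m"
  by (cases "c = 0") (simp_all add: eval_tpoly_def)

lemma eval_tpoly_mult: "eval_tpoly q (f * g) = eval_tpoly q f * eval_tpoly q g"
proof (induction f rule: poly_mapping_sum_induct)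
  case (single k c)
  show ?case
  proof (induction g rule: poly_mapping_sum_induct)
    case (single l d)
    show ?case by (simp add: mult_single eval_tpoly_single eval_mon_add ac_simps)
  qed (simp_all add: eval_tpoly_zero eval_tpoly_add distrib_left)
qed (simp_all add: eval_tpoly_zero eval_tpoly_add distrib_right)

lemma eval_tpoly_const: "eval_tpoly q (Poly_Mapping.single 0 c) = [:c:]"
  by (simp add: eval_tpoly_single eval_mon_def)

lemma eval_tpoly_one: "eval_tpoly q 1 = 1"
  using eval_tpoly_const[of q 1] by (simp add: one_pCons)

lemma eval_tpoly_var: "eval_tpoly q (var i) = q i"
  by (simp add: var_def eval_tpoly_single eval_mon_def)

lemma eval_tpoly_sum: "eval_tpoly q (\<Sum>x\<in>A. f x) = (\<Sum>x\<in>A. eval_tpoly q (f x))"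
  by (induction A rule: infinite_finite_induct) (simp_all add: eval_tpoly_zero eval_tpoly_add)

lemma eval_tpoly_power: "eval_tpoly q (f ^ k) = eval_tpoly q f ^ k"
  by (induction k) (simp_all add: eval_tpoly_one eval_tpoly_mult)

lemma eval_tpoly_diff: "eval_tpoly q (f - g) = eval_tpoly q f - eval_tpoly q g"
  using eval_tpoly_add[of q "f - g" g] by simp

definition is_ideal :: "'a::comm_ring_1 set \<Rightarrow> bool" where
  "is_ideal H \<longleftrightarrow> 0 \<in> H \<and> (\<forall>x\<in>H. \<forall>y\<in>H. x + y \<in> H) \<and> (\<forall>x\<in>H. \<forall>c. c * x \<in> H)"

lemma is_ideal_zero: "is_ideal H \<Longrightarrow> 0 \<in> H"
  and is_ideal_add: "is_ideal H \<Longrightarrow> x \<in> H \<Longrightarrow> y \<in> H \<Longrightarrow> x + y \<in> H"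
  and is_ideal_mult: "is_ideal H \<Longrightarrow> x \<in> H \<Longrightarrow> c * x \<in> H"
  by (auto simp: is_ideal_def)

lemma is_ideal_sum: "is_ideal H \<Longrightarrow> (\<And>x. x \<in> A \<Longrightarrow> f x \<in> H) \<Longrightarrow> (\<Sum>x\<in>A. f x) \<in> H"
  by (induction A rule: infinite_finite_induct) (auto simp: is_ideal_zero intro: is_ideal_add)

lemma is_ideal_ideal_gen: "is_ideal (ideal_gen S)"
  unfolding is_ideal_def
proof (intro conjI ballI allI)
  show "0 \<in> ideal_gen S"
    unfolding ideal_gen_def by (rule CollectI, rule exI[of _ "{}"]) auto
next
  fix x y assume "x \<in> ideal_gen S" "y \<in> ideal_gen S"
  then obtain A c B d where x: "x = (\<Sum>s\<in>A. c s * s)" "finite A" "A \<subseteq> S"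
    and y: "y = (\<Sum>s\<in>B. d s * s)" "finite B" "B \<subseteq> S" by (auto simp: ideal_gen_def)
  define e where "e s = (if s \<in> A then c s else 0) + (if s \<in> B then d s else 0)" for s
  have "(\<Sum>s\<in>A \<union> B. e s * s) =
      (\<Sum>s\<in>A \<union> B. (if s \<in> A then c s else 0) * s) + (\<Sum>s\<in>A \<union> B. (if s \<in> B then d s else 0) * s)"
    by (simp add: e_def distrib_right sum.distrib)
  also have "(\<Sum>s\<in>A \<union> B. (if s \<in> A then c s else 0) * s) = (\<Sum>s\<in>A. c s * s)"
    by (rule sum.mono_neutral_cong_right) (use x y in auto)
  also have "(\<Sum>s\<in>A \<union> B. (if s \<in> B then d s else 0) * s) = (\<Sum>s\<in>B. d s * s)"
    by (rule sum.mono_neutral_cong_right) (use x y in auto)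
  finally have "x + y = (\<Sum>s\<in>A \<union> B. e s * s)" using x y by simp
  then show "x + y \<in> ideal_gen S" unfolding ideal_gen_def using x y by blast
next
  fix x b assume "x \<in> ideal_gen S"
  then obtain A c where x: "x = (\<Sum>s\<in>A. c s * s)" "finite A" "A \<subseteq> S" by (auto simp: ideal_gen_def)
  then have "b * x = (\<Sum>s\<in>A. (b * c s) * s)" by (simp add: sum_distrib_left mult.assoc)
  then show "b * x \<in> ideal_gen S"
    unfolding ideal_gen_def using x by (intro CollectI exI[of _ A] exI[of _ "\<lambda>s. b * c s"]) simp
qed

lemma ideal_gen_incl: "s \<in> S \<Longrightarrow> s \<in> ideal_gen S"
  unfolding ideal_gen_def by (rule CollectI, rule exI[of _ "{s}"], rule exI[of _ "\<lambda>_. 1"]) auto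

lemma ideal_gen_least:
  assumes "is_ideal H" "S \<subseteq> H" shows "ideal_gen S \<subseteq> H"
  using assms by (auto simp: ideal_gen_def intro!: is_ideal_sum is_ideal_mult)

section \<open>Linear change of variables\<close>

text \<open>Outside {1..n} the only value is 0, so the cells form a product over all natural numbers
  and no range condition on j is carried along.\<close>

definition cellvals :: "nat \<Rightarrow> (nat \<Rightarrow> nat) \<Rightarrow> nat \<Rightarrow> nat set" where
  "cellvals n a j = (if j \<in> {1..n} then {1..a j} else {0})"

text \<open>In the new variables the last value \<open>a j\<close> of coordinate j stands for +, so that the new variables
  are again indexed by cells.\<close>

definition plusval :: "nat \<Rightarrow> (nat \<Rightarrow> nat) \<Rightarrow> nat \<Rightarrow> nat" where
  "plusval n a j = (if j \<in> {1..n} then a j else 0)"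

lemma cells_iff: "\<sigma> \<in> cells n a \<longleftrightarrow> (\<forall>j. \<sigma> j \<in> cellvals n a j)"
  unfolding cells_def cellvals_def by (auto split: if_splits)

lemma finite_cellvals: "finite (cellvals n a j)" by (simp add: cellvals_def)

lemma finite_cells: "finite (cells n a)"
proof -
  have "cells n a \<subseteq> {f. \<forall>x. (x \<in> {1..n} \<longrightarrow> f x \<in> (\<Union>j\<in>{1..n}. {1..a j})) \<and> (x \<notin> {1..n} \<longrightarrow> f x = 0)}"
    by (fastforce simp: cells_def)
  then show ?thesis
    by (rule finite_subset) (rule finite_set_of_finite_funs, auto)
qed

text \<open>The coordinates in T are those already changed: there the marginal value is read as +. T
  empty gives the old variables and {1..n} the new ones, so the change of variables can be made, or
  undone, one coordinate at a time.\<close>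

definition partial_sum :: "nat \<Rightarrow> (nat \<Rightarrow> nat) \<Rightarrow> nat set \<Rightarrow> ((nat \<Rightarrow> nat) \<Rightarrow> 'b::ab_group_add) \<Rightarrow> (nat \<Rightarrow> nat) \<Rightarrow> 'b" where
  "partial_sum n a T q \<sigma> =
     (\<Sum>i\<in>{i\<in>cells n a. \<forall>j. j \<notin> T \<or> \<sigma> j \<noteq> plusval n a j \<longrightarrow> i j = \<sigma> j}. q i)"

lemma partial_sum_empty: "\<sigma> \<in> cells n a \<Longrightarrow> partial_sum n a {} q \<sigma> = q \<sigma>"
proof -
  assume "\<sigma> \<in> cells n a"
  then have "{i\<in>cells n a. \<forall>j. j \<notin> {} \<or> \<sigma> j \<noteq> plusval n a j \<longrightarrow> i j = \<sigma> j} = {\<sigma>}" by auto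
  then show ?thesis by (simp only: partial_sum_def) simp
qed

lemma partial_sum_insert_ne:
  assumes "\<sigma> j \<noteq> plusval n a j"
  shows "partial_sum n a (insert j T) q \<sigma> = partial_sum n a T q \<sigma>"
  unfolding partial_sum_def
  by (rule arg_cong2[where f = sum]) (use assms in auto)

lemma partial_sum_insert_eq:
  assumes "j \<notin> T" "\<sigma> j = plusval n a j"
  shows "partial_sum n a (insert j T) q \<sigma> = (\<Sum>c\<in>cellvals n a j. partial_sum n a T q (\<sigma>(j := c)))"
proof -
  define S where "S = {i\<in>cells n a. \<forall>k. k \<notin> insert j T \<or> \<sigma> k \<noteq> plusval n a k \<longrightarrow> i k = \<sigma> k}"
  have "{i\<in>cells n a. \<forall>k. k \<notin> T \<or> (\<sigma>(j := c)) k \<noteq> plusval n a k \<longrightarrow> i k = (\<sigma>(j := c)) k} =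
      {i\<in>S. i j = c}" for c
    using assms by (auto simp: S_def)
  then have "(\<Sum>c\<in>cellvals n a j. partial_sum n a T q (\<sigma>(j := c))) =
      (\<Sum>c\<in>cellvals n a j. \<Sum>i\<in>{i\<in>S. i j = c}. q i)"
    by (simp only: partial_sum_def)
  also have "\<dots> = (\<Sum>i\<in>S. q i)"
  proof (rule sum.group)
    show "finite S" using finite_cells[of n a] by (simp add: S_def)
  qed (auto simp: S_def finite_cellvals cells_iff)
  finally show ?thesis by (simp add: partial_sum_def S_def)
qed

lemma cells_upd: "\<sigma> \<in> cells n a \<Longrightarrow> c \<in> cellvals n a j \<Longrightarrow> \<sigma>(j := c) \<in> cells n a"
  by (auto simp: cells_iff)

text \<open>Weights prescribe the values of the new variables, while a homomorphism is given on the
  old ones. Each coordinate is a unitriangular system, solved by subtraction.\<close>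

lemma exists_partial_sum:
  assumes "finite T"
  shows "\<exists>q. \<forall>\<sigma>\<in>cells n a. partial_sum n a T q \<sigma> = (p \<sigma> :: 'b::ab_group_add)"
  using assms
proof (induction T arbitrary: p)
  case empty
  show ?case by (intro exI[of _ p]) (simp add: partial_sum_empty)
next
  case (insert j T)
  let ?z = "plusval n a j" and ?Q = "cellvals n a j"
  \<comment> \<open>At the marginal value the sum over all values of coordinate j is prescribed;
    removing the other entries leaves the entry at the last value.\<close>
  define p' where "p' \<sigma> = (if \<sigma> j = ?z then p \<sigma> - (\<Sum>c\<in>?Q - {?z}. p (\<sigma>(j := c))) else p \<sigma>)" for \<sigma>
  obtain q where q: "\<And>\<sigma>. \<sigma> \<in> cells n a \<Longrightarrow> partial_sum n a T q \<sigma> = p' \<sigma>"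
    using insert.IH[of p'] by blast
  have "partial_sum n a (insert j T) q \<sigma> = p \<sigma>" if \<sigma>: "\<sigma> \<in> cells n a" for \<sigma>
  proof (cases "\<sigma> j = ?z")
    case False
    then show ?thesis using q[OF \<sigma>] by (simp add: partial_sum_insert_ne p'_def)
  next
    case True
    then have zQ: "?z \<in> ?Q" using \<sigma> by (metis cells_iff)
    have triv: "\<sigma>(j := ?z) = \<sigma>" using True by auto
    have "partial_sum n a (insert j T) q \<sigma> = (\<Sum>c\<in>?Q. partial_sum n a T q (\<sigma>(j := c)))"
      by (rule partial_sum_insert_eq) (use insert.hyps True in auto)
    also have "\<dots> = (\<Sum>c\<in>?Q. p' (\<sigma>(j := c)))"
      by (rule sum.cong) (use q cells_upd[OF \<sigma>] in auto)
    also have "\<dots> = p' \<sigma> + (\<Sum>c\<in>?Q - {?z}. p' (\<sigma>(j := c)))"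
      using sum.remove[OF finite_cellvals zQ, of "\<lambda>c. p' (\<sigma>(j := c))"] by (simp only: triv)
    also have "\<dots> = p' \<sigma> + (\<Sum>c\<in>?Q - {?z}. p (\<sigma>(j := c)))"
      by (intro arg_cong2[where f = "(+)"] sum.cong refl) (simp add: p'_def)
    finally have "partial_sum n a (insert j T) q \<sigma> = p' \<sigma> + (\<Sum>c\<in>?Q - {?z}. p (\<sigma>(j := c)))" .
    moreover have "p' \<sigma> = p \<sigma> - (\<Sum>c\<in>?Q - {?z}. p (\<sigma>(j := c)))" using True by (simp add: p'_def)
    ultimately show ?thesis by (simp only: diff_add_cancel)
  qed
  then show ?case by blast
qed

text \<open>The ring has a variable for every function, not only for cells; the additional ones are
  left as they are, so that the new variables generate the whole ring.\<close>

definition newvar :: "nat \<Rightarrow> (nat \<Rightarrow> nat) \<Rightarrow> (nat \<Rightarrow> nat) \<Rightarrow> 'k::comm_ring_1 tpoly" where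
  "newvar n a \<sigma> = (if \<sigma> \<in> cells n a then partial_sum n a {1..n} var \<sigma> else var \<sigma>)"

definition newmon :: "nat \<Rightarrow> (nat \<Rightarrow> nat) \<Rightarrow> (nat \<Rightarrow> nat) multiset \<Rightarrow> 'k::comm_ring_1 tpoly" where
  "newmon n a u = (\<Prod>\<sigma>\<in>#u. newvar n a \<sigma>)"

section \<open>The new monomials span the ring\<close>

inductive_set newspan :: "nat \<Rightarrow> (nat \<Rightarrow> nat) \<Rightarrow> 'k::comm_ring_1 tpoly set" for n a where
  zero: "0 \<in> newspan n a"
| add_term: "f \<in> newspan n a \<Longrightarrow> f + Poly_Mapping.single 0 c * newmon n a u \<in> newspan n a"

lemma newspan_add: "g \<in> newspan n a \<Longrightarrow> f \<in> newspan n a \<Longrightarrow> f + g \<in> newspan n a"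
  by (induction rule: newspan.induct) (auto simp flip: add.assoc intro: newspan.add_term)

lemma newspan_mult_var: "(f :: 'k::comm_ring_1 tpoly) \<in> newspan n a \<Longrightarrow> f * newvar n a \<sigma> \<in> newspan n a"
proof (induction rule: newspan.induct)
  case (add_term f c u)
  have "newmon n a u * newvar n a \<sigma> = (newmon n a (add_mset \<sigma> u) :: 'k tpoly)"
    by (simp add: newmon_def mult.commute)
  then have "(f + Poly_Mapping.single 0 c * newmon n a u) * newvar n a \<sigma> =
      f * newvar n a \<sigma> + Poly_Mapping.single 0 c * newmon n a (add_mset \<sigma> u)"
    by (simp add: distrib_right mult.assoc)
  then show ?case using newspan.add_term[OF add_term.IH] by metis
qed (simp add: newspan.zero)

lemma newspan_mult_const: "f \<in> newspan n a \<Longrightarrow> f * Poly_Mapping.single 0 d \<in> newspan n a"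
proof (induction rule: newspan.induct)
  case (add_term f c u)
  have "(f + Poly_Mapping.single 0 c * newmon n a u) * Poly_Mapping.single 0 d =
      f * Poly_Mapping.single 0 d + Poly_Mapping.single 0 (c * d) * newmon n a u"
    by (simp add: distrib_right mult.assoc mult_single flip: mult.assoc[of "newmon n a u"])
      (simp add: ac_simps mult_single flip: mult.assoc[of "Poly_Mapping.single 0 c"])
  then show ?case using newspan.add_term[OF add_term.IH] by metis
qed (simp add: newspan.zero)

text \<open>Spanning is proved without writing down the inverse substitution: the multipliers of the
  span form a subring containing the constants and the new variables. Once the old variables are in
  it, it is everything, and as 1 lies in the span, so does each polynomial.\<close>

definition multipliers :: "nat \<Rightarrow> (nat \<Rightarrow> nat) \<Rightarrow> 'k::comm_ring_1 tpoly set" where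
  "multipliers n a = {p. \<forall>f\<in>newspan n a. f * p \<in> newspan n a}"

lemma multipliers_add: "p \<in> multipliers n a \<Longrightarrow> q \<in> multipliers n a \<Longrightarrow> p + q \<in> multipliers n a"
  by (auto simp: multipliers_def distrib_left intro: newspan_add)

lemma multipliers_mult: "p \<in> multipliers n a \<Longrightarrow> q \<in> multipliers n a \<Longrightarrow> p * q \<in> multipliers n a"
  by (auto simp: multipliers_def simp flip: mult.assoc)

lemma multipliers_const: "Poly_Mapping.single 0 c \<in> multipliers n a"
  by (auto simp: multipliers_def intro: newspan_mult_const)

lemma multipliers_diff: "p \<in> multipliers n a \<Longrightarrow> q \<in> multipliers n a \<Longrightarrow> p - q \<in> multipliers n a"
  using multipliers_add[OF _ multipliers_mult[OF _ multipliers_const[of "-1"]], of p n a q]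
  by (simp add: single_uminus)

lemma multipliers_zero: "0 \<in> multipliers n a" using multipliers_const[of 0 n a] by simp

lemma multipliers_one: "1 \<in> multipliers n a" using multipliers_const[of 1 n a] by simp

lemma multipliers_sum: "(\<And>x. x \<in> A \<Longrightarrow> f x \<in> multipliers n a) \<Longrightarrow> (\<Sum>x\<in>A. f x) \<in> multipliers n a"
  by (induction A rule: infinite_finite_induct) (auto simp: multipliers_zero intro: multipliers_add)

text \<open>D is the set of coordinates at which the change of variables has been undone. The sum at
  the marginal value of j minus the entries at the other values gives back the entry at the last
  value, so each step stays inside the subring.\<close>

lemma partial_sum_in_multipliers:
  assumes "finite D" "D \<subseteq> {1..n}"
  shows "\<sigma> \<in> cells n a \<Longrightarrow>
    (partial_sum n a ({1..n} - D) var \<sigma> :: 'k::comm_ring_1 tpoly) \<in> multipliers n a"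
  using assms
proof (induction D arbitrary: \<sigma>)
  case empty
  then have "partial_sum n a ({1..n} - {}) var \<sigma> = (newvar n a \<sigma> :: 'k tpoly)" by (simp add: newvar_def)
  then show ?case by (simp add: multipliers_def newspan_mult_var)
next
  case (insert j D)
  let ?z = "plusval n a j" and ?Q = "cellvals n a j"
  define T where "T = {1..n} - insert j D"
  have T: "{1..n} - D = insert j T" "j \<notin> T" using insert.hyps insert.prems by (auto simp: T_def)
  have IH: "(partial_sum n a (insert j T) var \<sigma> :: 'k tpoly) \<in> multipliers n a" if "\<sigma> \<in> cells n a" for \<sigma>
    using insert.IH[OF that] insert.prems T by simp
  have ne: "(partial_sum n a T var \<sigma> :: 'k tpoly) \<in> multipliers n a" if "\<sigma> \<in> cells n a" "\<sigma> j \<noteq> ?z" for \<sigma>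
    using IH[OF that(1)] partial_sum_insert_ne[where \<sigma> = \<sigma> and j = j and T = T and q = "var :: _ \<Rightarrow> 'k tpoly", OF that(2)]
    by (simp only:)
  show ?case
  proof (cases "\<sigma> j = ?z")
    case False
    then show ?thesis using ne insert.prems(1) by (simp add: T_def)
  next
    case True
    then have zQ: "?z \<in> ?Q" using insert.prems(1) by (metis cells_iff)
    have triv: "\<sigma>(j := ?z) = \<sigma>" using True by auto
    have "(partial_sum n a (insert j T) var \<sigma> :: 'k tpoly) =
        (\<Sum>c\<in>?Q. partial_sum n a T var (\<sigma>(j := c)))"
      by (rule partial_sum_insert_eq) (use T True in auto)
    also have "\<dots> = partial_sum n a T var \<sigma> + (\<Sum>c\<in>?Q - {?z}. partial_sum n a T var (\<sigma>(j := c)))"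
      using sum.remove[OF finite_cellvals zQ, of "\<lambda>c. partial_sum n a T var (\<sigma>(j := c))"]
      by (simp only: triv)
    finally have "(partial_sum n a T var \<sigma> :: 'k tpoly) =
      partial_sum n a (insert j T) var \<sigma> - (\<Sum>c\<in>?Q - {?z}. partial_sum n a T var (\<sigma>(j := c)))"
      by (simp add: algebra_simps)
    moreover have "\<dots> \<in> multipliers n a"
      by (intro multipliers_diff multipliers_sum IH ne cells_upd) (use insert.prems(1) in auto)
    ultimately show ?thesis by (simp add: T_def)
  qed
qed

lemma var_in_multipliers: "(var i :: 'k::comm_ring_1 tpoly) \<in> multipliers n a"
proof (cases "i \<in> cells n a")
  case True
  then show ?thesis
    using partial_sum_in_multipliers[of "{1..n}" n i a] by (simp add: partial_sum_empty)
next
  case False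
  then have "(var i :: 'k tpoly) = newvar n a i" by (simp add: newvar_def)
  then show ?thesis by (simp add: multipliers_def newspan_mult_var)
qed

lemma tpoly_in_multipliers: "(f :: 'k::comm_ring_1 tpoly) \<in> multipliers n a"
proof (induction f rule: poly_mapping_sum_induct)
  case (single m c)
  have pow: "Poly_Mapping.single (Poly_Mapping.single i k) (1::'k) \<in> multipliers n a" for i k
  proof (induction k)
    case (Suc k)
    have "Poly_Mapping.single (Poly_Mapping.single i (Suc k)) (1::'k) =
        Poly_Mapping.single (Poly_Mapping.single i k) 1 * var i"
      by (simp add: var_def mult_single flip: single_add)
    then show ?case using Suc var_in_multipliers multipliers_mult by metis
  qed (simp add: multipliers_one)
  have "Poly_Mapping.single m (1::'k) \<in> multipliers n a"
  proof (induction m rule: poly_mapping_sum_induct)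
    case (add m m')
    then show ?case using multipliers_mult[OF add.IH] by (simp add: mult_single)
  qed (simp_all add: multipliers_one pow)
  from multipliers_mult[OF multipliers_const this, of c] show ?case by (simp add: mult_single)
qed (auto intro: multipliers_add multipliers_zero)

lemma tpoly_eq_comb:
  fixes f :: "'k::comm_ring_1 tpoly"
  shows "\<exists>U c. finite U \<and> f = (\<Sum>u\<in>U. Poly_Mapping.single 0 (c u) * newmon n a u)"
proof -
  have "(1 :: 'k tpoly) \<in> newspan n a"
    using newspan.add_term[OF newspan.zero, where c = 1 and u = "{#}"] by (simp add: newmon_def)
  then have "1 * f \<in> newspan n a" using tpoly_in_multipliers[of f n a] unfolding multipliers_def by blast
  then have "f \<in> newspan n a" by simp
  then show ?thesis
  proof (induction rule: newspan.induct)
    case zero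
    show ?case by (rule exI[of _ "{}"]) simp
  next
    case (add_term f d u)
    then obtain U c where U: "finite U" "f = (\<Sum>u\<in>U. Poly_Mapping.single 0 (c u) * newmon n a u)" by blast
    define c' where "c' v = (if v \<in> U then c v else 0) + (if v = u then d else 0)" for v
    have "(\<Sum>v\<in>insert u U. Poly_Mapping.single 0 (c' v) * newmon n a v) =
      (\<Sum>v\<in>insert u U. Poly_Mapping.single 0 (if v \<in> U then c v else 0) * newmon n a v) +
      (\<Sum>v\<in>insert u U. Poly_Mapping.single 0 (if v = u then d else 0) * newmon n a v)"
      by (simp add: c'_def single_add distrib_right sum.distrib)
    also have "(\<Sum>v\<in>insert u U. Poly_Mapping.single 0 (if v \<in> U then c v else 0) * newmon n a v) = f"
      unfolding U(2) by (rule sum.mono_neutral_cong_right) (use U(1) in auto)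
    also have "(\<Sum>v\<in>insert u U. Poly_Mapping.single 0 (if v = u then d else 0) * newmon n a v) =
        (\<Sum>v\<in>{u}. Poly_Mapping.single 0 d * newmon n a v)"
      by (rule sum.mono_neutral_cong_right) (use U(1) in auto)
    finally show ?case using U(1) by (intro exI[of _ "insert u U"] exI[of _ c']) simp
  qed
qed

section \<open>The ideal in the new variables\<close>

abbreviation face_cells :: "nat \<Rightarrow> (nat \<Rightarrow> nat) \<Rightarrow> nat set \<Rightarrow> (nat \<Rightarrow> nat) set" where
  "face_cells n a G \<equiv> cells_on (cellvals n a) (plusval n a) G"

lemma face_cells_subset: "\<sigma> \<in> face_cells n a G \<Longrightarrow> \<sigma> \<in> cells n a"
  by (simp add: cells_on_def cells_iff)

definition swap_binomials :: "nat \<Rightarrow> (nat \<Rightarrow> nat) \<Rightarrow> (nat \<Rightarrow> nat set) \<Rightarrow> 'k::comm_ring_1 tpoly set" where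
  "swap_binomials n a F = {newvar n a \<sigma> * newvar n a \<tau> - newvar n a (\<sigma>(l := \<tau> l)) * newvar n a (\<tau>(l := \<sigma> l))
     | i \<sigma> \<tau> l. i < 3 \<and> \<sigma> \<in> face_cells n a (F i) \<and> \<tau> \<in> face_cells n a (F i)}"

text \<open>A move changes a monomial by a multiple of one generator, and the differences
  telescope.\<close>

lemma swap_equiv_newmon_diff:
  assumes "swap_equiv (cellvals n a) (plusval n a) F u v"
  shows "newmon n a u - newmon n a v \<in> ideal_gen (swap_binomials n a F :: 'k::comm_ring_1 tpoly set)"
  using assms
proof (induction rule: rtranclp_induct)
  case base
  show ?case by (simp add: is_ideal_zero[OF is_ideal_ideal_gen])
next
  case (step v w)
  from step.hyps(2) have "newmon n a v - newmon n a w \<in> ideal_gen (swap_binomials n a F :: 'k tpoly set)"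
  proof cases
    case (1 i \<sigma> \<tau> M l)
    have "newmon n a v - newmon n a w = newmon n a M *
      (newvar n a \<sigma> * newvar n a \<tau> - newvar n a (\<sigma>(l := \<tau> l)) * newvar n a (\<tau>(l := \<sigma> l)) :: 'k tpoly)"
      unfolding 1 newmon_def by (simp add: algebra_simps)
    moreover have "newvar n a \<sigma> * newvar n a \<tau> - newvar n a (\<sigma>(l := \<tau> l)) * newvar n a (\<tau>(l := \<sigma> l))
        \<in> ideal_gen (swap_binomials n a F :: 'k tpoly set)"
      using 1 unfolding swap_binomials_def by (intro ideal_gen_incl) blast
    ultimately show ?thesis by (simp add: is_ideal_mult[OF is_ideal_ideal_gen])
  qed
  from is_ideal_add[OF is_ideal_ideal_gen step.IH this] show ?case by simp
qed

section \<open>Radicality of the binomial ideal\<close>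

definition tpow :: "enat \<Rightarrow> 'k::field poly" where
  "tpow e = (case e of enat k \<Rightarrow> monom 1 k | \<infinity> \<Rightarrow> 0)"

lemma tpow_add: "tpow (d + e) = tpow d * tpow e"
  by (cases d; cases e) (simp_all add: tpow_def mult_monom)

lemma tpow_zero: "tpow 0 = 1"
  by (simp add: tpow_def zero_enat_def one_pCons monom_0)

text \<open>Invariance of the weight makes the generators vanish when each new variable becomes its
  power of t. Suitable values for the old variables come from solving the change of
  variables.\<close>

lemma exists_weight_hom:
  fixes w :: "(nat \<Rightarrow> nat) \<Rightarrow> enat"
  assumes w: "inv_weight (cellvals n a) (plusval n a) F w"
  shows "\<exists>q :: (nat \<Rightarrow> nat) \<Rightarrow> 'k::field poly. (\<forall>u. eval_tpoly q (newmon n a u) = tpow (weight w u)) \<and>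
    (\<forall>f \<in> ideal_gen (swap_binomials n a F). eval_tpoly q f = 0)"
proof -
  obtain q0 where q0: "\<And>\<sigma>. \<sigma> \<in> cells n a \<Longrightarrow> partial_sum n a {1..n} q0 \<sigma> = (tpow (w \<sigma>) :: 'k poly)"
    using exists_partial_sum[of "{1..n}" n a "\<lambda>\<sigma>. tpow (w \<sigma>) :: 'k poly"] by auto
  define q where "q \<sigma> = (if \<sigma> \<in> cells n a then q0 \<sigma> else tpow (w \<sigma>))" for \<sigma>
  have nv: "eval_tpoly q (newvar n a \<sigma>) = tpow (w \<sigma>)" for \<sigma>
  proof (cases "\<sigma> \<in> cells n a")
    case True
    have "eval_tpoly q (newvar n a \<sigma>) = partial_sum n a {1..n} q \<sigma>"
      using True by (simp add: newvar_def partial_sum_def eval_tpoly_sum eval_tpoly_var)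
    also have "\<dots> = partial_sum n a {1..n} q0 \<sigma>"
      unfolding partial_sum_def by (rule sum.cong) (auto simp: q_def)
    finally show ?thesis using q0[OF True] by simp
  qed (simp add: newvar_def eval_tpoly_var q_def)
  have nm: "eval_tpoly q (newmon n a u) = tpow (weight w u)" for u
    by (induction u) (simp_all add: newmon_def eval_tpoly_one eval_tpoly_mult nv tpow_zero tpow_add)
  have "is_ideal {f. eval_tpoly q f = 0}"
    by (simp add: is_ideal_def eval_tpoly_zero eval_tpoly_add eval_tpoly_mult)
  moreover have "swap_binomials n a F \<subseteq> {f. eval_tpoly q f = 0}"
  proof
    fix f :: "'k tpoly" assume "f \<in> swap_binomials n a F"
    then obtain i \<sigma> \<tau> l where f: "f = newvar n a \<sigma> * newvar n a \<tau> -
        newvar n a (\<sigma>(l := \<tau> l)) * newvar n a (\<tau>(l := \<sigma> l))"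
      and i: "i < 3" "\<sigma> \<in> face_cells n a (F i)" "\<tau> \<in> face_cells n a (F i)"
      by (auto simp: swap_binomials_def)
    have "w \<sigma> + w \<tau> = w (\<sigma>(l := \<tau> l)) + w (\<tau>(l := \<sigma> l))" using w i unfolding inv_weight_def by blast
    then show "f \<in> {f. eval_tpoly q f = 0}"
      by (simp add: f eval_tpoly_diff eval_tpoly_mult nv flip: tpow_add)
  qed
  ultimately show ?thesis using nm ideal_gen_least by blast
qed

lemma radical_swap_binomials:
  assumes fin: "\<And>i. i < 3 \<Longrightarrow> finite (F i)"
  shows "radical_ideal (ideal_gen (swap_binomials n a F) :: 'k::field tpoly set)"
  unfolding radical_ideal_def
proof (intro allI impI)
  fix f :: "'k tpoly" and k
  let ?I = "ideal_gen (swap_binomials n a F) :: 'k tpoly set"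
  let ?comb = "\<lambda>U c. \<Sum>u\<in>U. Poly_Mapping.single 0 (c u) * newmon n a u :: 'k tpoly"
  note I = is_ideal_ideal_gen[of "swap_binomials n a F :: 'k tpoly set"]
  assume fk: "f ^ k \<in> ?I"
  show "f \<in> ?I"
  proof (rule ccontr)
    assume fI: "f \<notin> ?I"
    \<comment> \<open>f is represented modulo the ideal with as few monomials as possible. Then no
      coefficient is 0, and no two monomials are equivalent, as they could be merged.\<close>
    define P where "P N \<longleftrightarrow> (\<exists>U c. finite U \<and> card U = N \<and> f - ?comb U c \<in> ?I)" for N
    obtain U0 c0 where "finite U0" "f = ?comb U0 c0" using tpoly_eq_comb by blast
    then have "P (card U0)" unfolding P_def using is_ideal_zero[OF I]
      by (intro exI[of _ U0] exI[of _ c0]) simp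
    then have "P (LEAST N. P N)" by (rule LeastI)
    then obtain U c where U: "finite U" "card U = (LEAST N. P N)" and fU: "f - ?comb U c \<in> ?I"
      unfolding P_def by blast
    have small: "card U \<le> card V" if "finite V" "f - ?comb V d \<in> ?I" for V d
      unfolding U(2) by (rule Least_le) (use that in \<open>auto simp: P_def\<close>)
    have "U \<noteq> {}" using fU fI by auto
    have c0: "c u \<noteq> 0" if u: "u \<in> U" for u
    proof
      assume "c u = 0"
      then have "?comb U c = ?comb (U - {u}) c" 
        using sum.remove[OF U(1) u, of "\<lambda>u. Poly_Mapping.single 0 (c u) * newmon n a u"] by simp
      then have "card U \<le> card (U - {u})" using small[of "U - {u}" c] fU U(1) by simp
      then show False using card_Diff1_less[OF U(1) u] by simp
    qed
    have "\<not> weight_equiv (cellvals n a) (plusval n a) F u v" if uv: "u \<in> U" "v \<in> U" "u \<noteq> v" for u v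
    proof
      assume weight_equiv: "weight_equiv (cellvals n a) (plusval n a) F u v"
      have "swap_equiv (cellvals n a) (plusval n a) F u v" by (rule swap_equiv_if_weight_equiv[where F = F, OF fin weight_equiv])
      then have d: "newmon n a u - newmon n a v \<in> ?I" by (rule swap_equiv_newmon_diff)
      define c' where "c' = c(v := c u + c v)"
      have vU: "v \<in> U - {u}" using uv by auto
      have "?comb U c = Poly_Mapping.single 0 (c u) * newmon n a u + ?comb (U - {u}) c"
        by (rule sum.remove[OF U(1) uv(1)])
      also have "?comb (U - {u}) c = Poly_Mapping.single 0 (c v) * newmon n a v + ?comb (U - {u} - {v}) c"
        by (rule sum.remove) (use U(1) vU in auto)
      finally have 1: "?comb U c = Poly_Mapping.single 0 (c u) * newmon n a u +
        (Poly_Mapping.single 0 (c v) * newmon n a v + ?comb (U - {u} - {v}) c)" .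
      have "?comb (U - {u}) c' = Poly_Mapping.single 0 (c' v) * newmon n a v + ?comb (U - {u} - {v}) c'"
        by (rule sum.remove) (use U(1) vU in auto)
      also have "?comb (U - {u} - {v}) c' = ?comb (U - {u} - {v}) c"
        by (rule sum.cong) (auto simp: c'_def)
      finally have 2: "?comb (U - {u}) c' = Poly_Mapping.single 0 (c u) * newmon n a v +
          Poly_Mapping.single 0 (c v) * newmon n a v + ?comb (U - {u} - {v}) c"
        by (simp add: c'_def single_add distrib_right)
      have "f - ?comb (U - {u}) c' = (f - ?comb U c) + Poly_Mapping.single 0 (c u) * (newmon n a u - newmon n a v)"
        unfolding 1 2 by (simp add: algebra_simps)
      then have "f - ?comb (U - {u}) c' \<in> ?I"
        using is_ideal_add[OF I fU is_ideal_mult[OF I d]] by (simp only:)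
      then have "card U \<le> card (U - {u})" using small U(1) by blast
      then show False using card_Diff1_less[OF U(1) uv(1)] by simp
    qed
    then obtain w u where w: "inv_weight (cellvals n a) (plusval n a) F w" and u: "u \<in> U" "weight w u \<noteq> \<infinity>"
      "\<And>v. v \<in> U \<Longrightarrow> v \<noteq> u \<Longrightarrow> weight w v \<noteq> weight w u"
      using exists_isolating_weight[OF U(1) \<open>U \<noteq> {}\<close>, of "cellvals n a" "plusval n a" F] by blast
    obtain q :: "(nat \<Rightarrow> nat) \<Rightarrow> 'k poly" where q: "\<And>u. eval_tpoly q (newmon n a u) = tpow (weight w u)"
      "\<And>f. f \<in> ?I \<Longrightarrow> eval_tpoly q f = 0"
      using exists_weight_hom[OF w] by blast
    obtain N where N: "weight w u = enat N" using u(2) by auto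
    have "eval_tpoly q f ^ k = 0" using q(2)[OF fk] by (simp add: eval_tpoly_power)
    \<comment> \<open>K[t] is a domain; for k = 0 the equation would read 1 = 0.\<close>
    then have "eval_tpoly q f = 0" by (cases "k = 0") auto
    then have "eval_tpoly q (?comb U c) = 0" using q(2)[OF fU] by (simp add: eval_tpoly_diff)
    then have s0: "(\<Sum>v\<in>U. [:c v:] * tpow (weight w v)) = 0"
      by (simp only: eval_tpoly_sum eval_tpoly_mult eval_tpoly_const q(1))
    have s1: "(\<Sum>v\<in>U. coeff ([:c v:] * tpow (weight w v)) N) = 0"
      using arg_cong[OF s0, of "\<lambda>p. coeff p N"] by (simp only: coeff_sum coeff_0)
    \<comment> \<open>No other monomial of U contributes in degree N, so the coefficient there is
      \<open>c u\<close>.\<close>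
    have s2: "(\<Sum>v\<in>U. coeff ([:c v:] * tpow (weight w v)) N) = (\<Sum>v\<in>{u}. c v)"
    proof (rule sum.mono_neutral_cong_right)
      show "\<forall>v\<in>U - {u}. coeff ([:c v:] * tpow (weight w v)) N = 0"
      proof
        fix v assume "v \<in> U - {u}"
        then have "weight w v \<noteq> enat N" using u(3)[of v] N by simp
        then show "coeff ([:c v:] * tpow (weight w v)) N = 0"
          by (cases "weight w v") (auto simp: tpow_def)
      qed
    qed (use U(1) u(1) N in \<open>auto simp: tpow_def\<close>)
    show False using s1 c0[OF u(1)] unfolding s2 by simp
  qed
qed

section \<open>Minors of margins and exchange binomials generate the same ideal\<close>

definition xswap :: "nat \<Rightarrow> (nat \<Rightarrow> nat) \<Rightarrow> (nat \<Rightarrow> nat option) \<Rightarrow> (nat \<Rightarrow> nat option) \<Rightarrow> nat \<Rightarrow> 'k::comm_ring_1 tpoly" where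
  "xswap n a \<sigma> \<tau> l = xsum n a \<sigma> * xsum n a \<tau> - xsum n a (\<sigma>(l := \<tau> l)) * xsum n a (\<tau>(l := \<sigma> l))"

lemma xswap_commute: "xswap n a \<sigma> \<tau> l = xswap n a \<tau> \<sigma> l"
  by (simp add: xswap_def mult.commute)

text \<open>Linearity in one entry of the first index. For j = l the entry moves to the other index
  in the second product, but it still occurs once in each product, so linearity persists.\<close>

lemma xswap_expand:
  fixes c :: "nat option \<Rightarrow> 'k::comm_ring_1 tpoly"
  assumes "\<And>\<sigma>. xsum n a (\<sigma>(j := x)) = (\<Sum>y\<in>S. c y * xsum n a (\<sigma>(j := y)))"
  shows "xswap n a (\<sigma>(j := x)) \<tau> l = (\<Sum>y\<in>S. c y * xswap n a (\<sigma>(j := y)) \<tau> l)"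
proof (cases "j = l")
  case True
  have e: "xswap n a (\<sigma>(l := x)) \<tau> l = xsum n a (\<sigma>(l := x)) * xsum n a \<tau> -
      xsum n a (\<tau>(l := x)) * (xsum n a (\<sigma>(l := \<tau> l)) :: 'k tpoly)" for x
    by (simp add: xswap_def mult.commute)
  show ?thesis
    unfolding True e assms[unfolded True]
    by (simp only: sum_distrib_right right_diff_distrib sum_subtractf mult.assoc)
next
  case False
  have e: "xswap n a (\<sigma>(j := x)) \<tau> l = xsum n a (\<sigma>(j := x)) * xsum n a \<tau> -
      xsum n a ((\<sigma>(l := \<tau> l))(j := x)) * (xsum n a (\<tau>(l := \<sigma> l)) :: 'k tpoly)" for x
    using False by (simp add: xswap_def fun_upd_twist)
  show ?thesis
    unfolding e assms
    by (simp only: sum_distrib_right right_diff_distrib sum_subtractf mult.assoc)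
qed

text \<open>Multilinear extension: S holds the values occurring in the given generators,
  \<open>S'\<close> those to be reached. The relations expressing \<open>S'\<close> through S have
  coefficients independent of the other coordinates, so both indices can be expanded one coordinate
  at a time.\<close>

lemma xswap_extend:
  fixes H :: "'k::comm_ring_1 tpoly set"
  assumes H: "is_ideal H" and T: "finite T"
    and out: "\<And>j. j \<notin> T \<Longrightarrow> S' j \<subseteq> S j"
    and exp: "\<And>j x. j \<in> T \<Longrightarrow> x \<in> S' j \<Longrightarrow>
      \<exists>c. \<forall>\<sigma>. (xsum n a (\<sigma>(j := x)) :: 'k tpoly) = (\<Sum>y\<in>S j. c y * xsum n a (\<sigma>(j := y)))"
    and base: "\<And>\<sigma> \<tau>. (\<forall>j. \<sigma> j \<in> S j) \<Longrightarrow> (\<forall>j. \<tau> j \<in> S j) \<Longrightarrow> xswap n a \<sigma> \<tau> l \<in> H"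
    and \<sigma>: "\<And>j. \<sigma> j \<in> S' j" and \<tau>: "\<And>j. \<tau> j \<in> S' j"
  shows "xswap n a \<sigma> \<tau> l \<in> H"
proof -
  have main: "xswap n a \<sigma> \<tau> l \<in> H" if "T' \<subseteq> T" "finite T'"
    "\<And>j. \<sigma> j \<in> (if j \<in> T' then S' j else S j)" "\<And>j. \<tau> j \<in> (if j \<in> T' then S' j else S j)" for T' \<sigma> \<tau>
    using that(2,1,3,4)
  proof (induction T' arbitrary: \<sigma> \<tau>)
    case empty
    then show ?case using base by simp
  next
    case (insert j T')
    have jT: "j \<in> T" using insert.prems by simp
    have one: "xswap n a \<sigma> \<tau> l \<in> H"
      if "\<And>k. \<sigma> k \<in> (if k \<in> insert j T' then S' k else S k)" "\<And>k. \<tau> k \<in> (if k \<in> T' then S' k else S k)" for \<sigma> \<tau>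
    proof -
      have "\<sigma> j \<in> S' j" using that(1)[of j] by simp
      then obtain c where c: "\<forall>\<sigma>'. (xsum n a (\<sigma>'(j := \<sigma> j)) :: 'k tpoly) = (\<Sum>y\<in>S j. c y * xsum n a (\<sigma>'(j := y)))"
        using exp[OF jT] by blast
      have "xswap n a (\<sigma>(j := \<sigma> j)) \<tau> l = (\<Sum>y\<in>S j. c y * xswap n a (\<sigma>(j := y)) \<tau> l)"
        by (rule xswap_expand) (use c in blast)
      moreover have "xswap n a (\<sigma>(j := y)) \<tau> l \<in> H" if y: "y \<in> S j" for y
      proof (rule insert.IH)
        show "(\<sigma>(j := y)) k \<in> (if k \<in> T' then S' k else S k)" for k
          using that y insert.hyps(2) \<open>\<And>k. \<sigma> k \<in> (if k \<in> insert j T' then S' k else S k)\<close>[of k] by (auto split: if_splits)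
      qed (use insert.prems \<open>\<And>k. \<tau> k \<in> (if k \<in> T' then S' k else S k)\<close> in auto)
      moreover have "(\<Sum>y\<in>S j. c y * xswap n a (\<sigma>(j := y)) \<tau> l) \<in> H"
        by (intro is_ideal_sum[OF H] is_ideal_mult[OF H] calculation(2))
      ultimately show ?thesis by simp
    qed
    have "\<tau> j \<in> S' j" using insert.prems(3)[of j] by simp
    then obtain c where c: "\<forall>\<sigma>'. (xsum n a (\<sigma>'(j := \<tau> j)) :: 'k tpoly) = (\<Sum>y\<in>S j. c y * xsum n a (\<sigma>'(j := y)))"
      using exp[OF jT] by blast
    have "xswap n a (\<tau>(j := \<tau> j)) \<sigma> l = (\<Sum>y\<in>S j. c y * xswap n a (\<tau>(j := y)) \<sigma> l)"
      by (rule xswap_expand) (use c in blast)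
    moreover have "xswap n a (\<tau>(j := y)) \<sigma> l \<in> H" if y: "y \<in> S j" for y
      unfolding xswap_commute[of n a "\<tau>(j := y)"]
    proof (rule one)
      show "(\<tau>(j := y)) k \<in> (if k \<in> T' then S' k else S k)" for k
        using y insert.hyps(2) insert.prems(3)[of k] by (auto split: if_splits)
    qed (use insert.prems in auto)
    moreover have "(\<Sum>y\<in>S j. c y * xswap n a (\<tau>(j := y)) \<sigma> l) \<in> H"
      by (intro is_ideal_sum[OF H] is_ideal_mult[OF H] calculation(2))
    ultimately show ?case unfolding xswap_commute[of n a \<sigma> \<tau>] by simp
  qed
  show ?thesis
  proof (rule main[of T])
    show "\<sigma> j \<in> (if j \<in> T then S' j else S j)" "\<tau> j \<in> (if j \<in> T then S' j else S j)" for j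
      using \<sigma>[of j] \<tau>[of j] out[of j] by auto
  qed (use T in auto)
qed

lemma xsum_None:
  assumes "j \<in> {1..n}"
  shows "xsum n a (\<sigma>(j := None)) = (\<Sum>c\<in>{1..a j}. xsum n a (\<sigma>(j := Some c)) :: 'k::comm_ring_1 tpoly)"
proof -
  define S where "S = {i\<in>cells n a. \<forall>k\<in>{1..n}. (\<sigma>(j := None)) k \<noteq> None \<longrightarrow> i k = the ((\<sigma>(j := None)) k)}"
  have "(\<forall>k\<in>{1..n}. (\<sigma>(j := Some c)) k \<noteq> None \<longrightarrow> i k = the ((\<sigma>(j := Some c)) k)) \<longleftrightarrow>
      (\<forall>k\<in>{1..n}. (\<sigma>(j := None)) k \<noteq> None \<longrightarrow> i k = the ((\<sigma>(j := None)) k)) \<and> i j = c" for i c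
  proof -
    have "(\<forall>k\<in>{1..n}. P k) \<longleftrightarrow> (\<forall>k\<in>{1..n}. k \<noteq> j \<longrightarrow> P k) \<and> P j" for P using assms by metis
    from this[of "\<lambda>k. (\<sigma>(j := Some c)) k \<noteq> None \<longrightarrow> i k = the ((\<sigma>(j := Some c)) k)"]
      this[of "\<lambda>k. (\<sigma>(j := None)) k \<noteq> None \<longrightarrow> i k = the ((\<sigma>(j := None)) k)"]
    show ?thesis by simp
  qed
  then have "{i\<in>cells n a. \<forall>k\<in>{1..n}. (\<sigma>(j := Some c)) k \<noteq> None \<longrightarrow> i k = the ((\<sigma>(j := Some c)) k)} = {i\<in>S. i j = c}" for c
    by (simp only: S_def mem_Collect_eq conj_assoc)
  then have "(\<Sum>c\<in>{1..a j}. xsum n a (\<sigma>(j := Some c)) :: 'k tpoly) =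
      (\<Sum>c\<in>{1..a j}. \<Sum>i\<in>{i\<in>S. i j = c}. var i)"
    by (simp only: xsum_def)
  also have "\<dots> = (\<Sum>i\<in>S. var i)"
  proof (rule sum.group)
    show "finite S" using finite_cells[of n a] by (simp add: S_def)
    have "i j \<in> {1..a j}" if "i \<in> cells n a" for i using that assms by (simp add: cells_def)
    then show "(\<lambda>i. i j) ` S \<subseteq> {1..a j}" unfolding S_def by blast
  qed simp
  finally show ?thesis by (simp only: xsum_def S_def)
qed

definition to_opt :: "nat \<Rightarrow> (nat \<Rightarrow> nat) \<Rightarrow> (nat \<Rightarrow> nat) \<Rightarrow> nat \<Rightarrow> nat option" where
  "to_opt n a \<sigma> j = (if \<sigma> j = plusval n a j then None else Some (\<sigma> j))"

lemma newvar_eq_xsum: "\<sigma> \<in> cells n a \<Longrightarrow> newvar n a \<sigma> = xsum n a (to_opt n a \<sigma>)"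
proof -
  assume \<sigma>: "\<sigma> \<in> cells n a"
  have "(\<forall>j. j \<notin> {1..n} \<or> \<sigma> j \<noteq> plusval n a j \<longrightarrow> i j = \<sigma> j) \<longleftrightarrow>
    (\<forall>j\<in>{1..n}. to_opt n a \<sigma> j \<noteq> None \<longrightarrow> i j = the (to_opt n a \<sigma> j))"
    if i: "i \<in> cells n a" for i
  proof -
    have "i j = \<sigma> j" if "j \<notin> {1..n}" for j
    proof -
      have "i j = 0" "\<sigma> j = 0" using i \<sigma> that unfolding cells_def by blast+
      then show ?thesis by simp
    qed
    then have "(\<forall>j. j \<notin> {1..n} \<or> \<sigma> j \<noteq> plusval n a j \<longrightarrow> i j = \<sigma> j) \<longleftrightarrow>
      (\<forall>j\<in>{1..n}. \<sigma> j \<noteq> plusval n a j \<longrightarrow> i j = \<sigma> j)" by blast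
    also have "\<dots> \<longleftrightarrow> (\<forall>j\<in>{1..n}. to_opt n a \<sigma> j \<noteq> None \<longrightarrow> i j = the (to_opt n a \<sigma> j))"
      by (rule ball_cong) (simp_all add: to_opt_def)
    finally show ?thesis .
  qed
  then have "{i\<in>cells n a. \<forall>j. j \<notin> {1..n} \<or> \<sigma> j \<noteq> plusval n a j \<longrightarrow> i j = \<sigma> j} =
    {i\<in>cells n a. \<forall>j\<in>{1..n}. to_opt n a \<sigma> j \<noteq> None \<longrightarrow> i j = the (to_opt n a \<sigma> j)}"
    by blast
  with \<sigma> show ?thesis by (simp only: newvar_def partial_sum_def xsum_def if_True)
qed

lemma swap_binomial_eq_xswap:
  assumes "\<sigma> \<in> face_cells n a G" "\<tau> \<in> face_cells n a G"
  shows "newvar n a \<sigma> * newvar n a \<tau> - newvar n a (\<sigma>(l := \<tau> l)) * newvar n a (\<tau>(l := \<sigma> l)) =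
    xswap n a (to_opt n a \<sigma>) (to_opt n a \<tau>) l"
proof -
  have "to_opt n a (\<sigma>(l := \<tau> l)) = (to_opt n a \<sigma>)(l := to_opt n a \<tau> l)" for \<sigma> \<tau>
    by (auto simp: to_opt_def)
  moreover have "\<sigma> \<in> cells n a" "\<tau> \<in> cells n a" "\<sigma>(l := \<tau> l) \<in> cells n a" "\<tau>(l := \<sigma> l) \<in> cells n a"
    using face_cells_subset[OF assms(1)] face_cells_subset[OF assms(2)]
      face_cells_subset[OF cells_on_swap[OF assms]] face_cells_subset[OF cells_on_swap[OF assms(2,1)]] by auto
  ultimately show ?thesis by (simp add: newvar_eq_xsum xswap_def)
qed

definition opts :: "(nat \<Rightarrow> nat) \<Rightarrow> nat set \<Rightarrow> nat \<Rightarrow> nat option set" where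
  "opts a G j = (if j \<in> G then insert None (Some ` {1..a j}) else {None})"

lemma sum_indicator_mult:
  assumes "finite A" "x \<in> A"
  shows "(\<Sum>y\<in>A. (if y = x then 1 else 0) * g y) = (g x :: 'b::comm_ring_1)"
  by (subst sum.remove[OF assms]) simp

text \<open>In a margin over G no coordinate of G is summed. An index with + at such a coordinate is
  the sum over all values there, so it is reached by extension.\<close>

lemma xswap_in_if_minors:
  assumes H: "is_ideal H" and G: "G \<subseteq> {1..n}" and minors: "margin_minors n a G \<subseteq> H"
    and \<sigma>: "\<And>j. \<sigma> j \<in> opts a G j" and \<tau>: "\<And>j. \<tau> j \<in> opts a G j"
  shows "xswap n a \<sigma> \<tau> l \<in> (H :: 'k::comm_ring_1 tpoly set)"
proof (rule xswap_extend[where T = G and S' = "opts a G"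
      and S = "\<lambda>j. if j \<in> G then Some ` {1..a j} else {None}"])
  show "finite G" by (rule finite_subset[OF G]) simp
  fix j x assume j: "j \<in> G" and x: "x \<in> opts a G j"
  show "\<exists>c. \<forall>\<sigma>. (xsum n a (\<sigma>(j := x)) :: 'k tpoly) =
      (\<Sum>y\<in>(if j \<in> G then Some ` {1..a j} else {None}). c y * xsum n a (\<sigma>(j := y)))"
  proof (cases x)
    case None
    then show ?thesis
      using j G by (intro exI[of _ "\<lambda>_. 1"]) (auto simp: sum.reindex xsum_None)
  next
    case (Some b)
    then have "x \<in> Some ` {1..a j}" using x j by (auto simp: opts_def)
    then show ?thesis
      using j by (intro exI[of _ "\<lambda>y. if y = x then 1 else 0"] allI)
        (simp only: if_True, rule sum_indicator_mult[symmetric], simp_all)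
  qed
next
  fix \<sigma> \<tau> assume \<sigma>: "\<forall>j. \<sigma> j \<in> (if j \<in> G then Some ` {1..a j} else {None})"
    and \<tau>: "\<forall>j. \<tau> j \<in> (if j \<in> G then Some ` {1..a j} else {None})"
  show "xswap n a \<sigma> \<tau> l \<in> H"
  proof (cases "l \<in> G")
    case False
    then have "\<sigma> l = None" "\<tau> l = None" using \<sigma> \<tau> by (metis singletonD)+
    then have "\<sigma>(l := \<tau> l) = \<sigma>" "\<tau>(l := \<sigma> l) = \<tau>" by auto
    then show ?thesis using is_ideal_zero[OF H] by (simp add: xswap_def)
  next
    case True
    define i k where "i j = the (\<sigma> j)" and "k j = the (\<tau> j)" for j
    have ik: "1 \<le> i r \<and> i r \<le> a r \<and> \<sigma> r = Some (i r)" "1 \<le> k r \<and> k r \<le> a r \<and> \<tau> r = Some (k r)" if "r \<in> G" for r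
      using that \<sigma>[rule_format, of r] \<tau>[rule_format, of r] by (auto simp: i_def k_def)
    have n: "\<sigma> r = None" "\<tau> r = None" if "r \<notin> G" for r
      using that \<sigma>[rule_format, of r] \<tau>[rule_format, of r] by auto
    have m: "(\<lambda>j. if j \<in> G then Some (i j) else None) = \<sigma>" "(\<lambda>j. if j \<in> G then Some (k j) else None) = \<tau>"
      "(\<lambda>j. if j \<in> G then Some ((k(l := i l)) j) else None) = \<tau>(l := \<sigma> l)"
      "(\<lambda>j. if j \<in> G then Some ((i(l := k l)) j) else None) = \<sigma>(l := \<tau> l)"
      using ik n True by (auto simp: fun_eq_iff)
    have "(xswap n a \<sigma> \<tau> l :: 'k tpoly) =
        margin n a G i * margin n a G k - margin n a G (k(l := i l)) * margin n a G (i(l := k l))"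
      unfolding margin_def m by (simp add: xswap_def mult.commute)
    moreover have "\<dots> \<in> margin_minors n a G"
      unfolding margin_minors_def using ik True by blast
    ultimately show ?thesis using minors by auto
  qed
qed (use H \<sigma> \<tau> in \<open>auto simp: opts_def\<close>)

text \<open>The last value \<open>a j\<close> is missing from the indices of the new variables,
  being used for +; it is recovered as the + entry minus the entries at all other values.\<close>

lemma xswap_in_if_binomials:
  assumes H: "is_ideal H" and G: "F i \<subseteq> {1..n}" "i < 3" and bin: "swap_binomials n a F \<subseteq> H"
    and \<sigma>: "\<And>j. \<sigma> j \<in> opts a (F i) j" and \<tau>: "\<And>j. \<tau> j \<in> opts a (F i) j"
  shows "xswap n a \<sigma> \<tau> l \<in> (H :: 'k::comm_ring_1 tpoly set)"
proof (rule xswap_extend[where T = "F i" and S' = "opts a (F i)"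
      and S = "\<lambda>j. if j \<in> F i then insert None (Some ` {1..<a j}) else {None}"])
  show "finite (F i)" by (rule finite_subset[OF G(1)]) simp
  fix j x assume j: "j \<in> F i" and x: "x \<in> opts a (F i) j"
  show "\<exists>c. \<forall>\<sigma>. (xsum n a (\<sigma>(j := x)) :: 'k tpoly) =
      (\<Sum>y\<in>(if j \<in> F i then insert None (Some ` {1..<a j}) else {None}). c y * xsum n a (\<sigma>(j := y)))"
  proof (cases "x \<in> insert None (Some ` {1..<a j})")
    case True
    then show ?thesis
      using j by (intro exI[of _ "\<lambda>y. if y = x then 1 else 0"] allI)
        (simp only: if_True, rule sum_indicator_mult[symmetric], simp_all)
  next
    case False
    then have xa: "x = Some (a j)" "1 \<le> a j" using x j by (auto simp: opts_def image_iff)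
    have "(xsum n a (\<sigma>(j := x)) :: 'k tpoly) = (\<Sum>y\<in>insert None (Some ` {1..<a j}).
        (if y = None then 1 else - 1) * xsum n a (\<sigma>(j := y)))" for \<sigma>
    proof -
      have "{1..a j} = insert (a j) {1..<a j}" using xa(2) by auto
      then have "xsum n a (\<sigma>(j := None)) = xsum n a (\<sigma>(j := x)) +
          (\<Sum>c\<in>{1..<a j}. xsum n a (\<sigma>(j := Some c)) :: 'k tpoly)"
        using xsum_None[of j n a \<sigma>] j G xa(1) by auto
      moreover have "(\<Sum>y\<in>Some ` {1..<a j}. (if y = None then 1 else - 1) * xsum n a (\<sigma>(j := y)))
          = - (\<Sum>c\<in>{1..<a j}. xsum n a (\<sigma>(j := Some c)) :: 'k tpoly)"
        by (simp add: sum.reindex sum_negf)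
      ultimately show ?thesis by (subst sum.insert) auto
    qed
    then show ?thesis using j by (intro exI[of _ "\<lambda>y. if y = None then 1 else - 1"]) simp
  qed
next
  fix \<sigma> \<tau> assume \<sigma>: "\<forall>j. \<sigma> j \<in> (if j \<in> F i then insert None (Some ` {1..<a j}) else {None})"
    and \<tau>: "\<forall>j. \<tau> j \<in> (if j \<in> F i then insert None (Some ` {1..<a j}) else {None})"
  show "xswap n a \<sigma> \<tau> l \<in> H"
  proof (cases "\<exists>j\<in>{1..n}. a j = 0")
    \<comment> \<open>The table is empty. The marginal value at j is then not an admissible value,
      so the indices do not come from cells, but all sums vanish.\<close>
    case True
    then obtain j where j: "j \<in> {1..n}" "a j = 0" by blast
    have "i \<notin> cells n a" for i
    proof
      assume "i \<in> cells n a"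
      then have "1 \<le> i j \<and> i j \<le> a j" using j(1) unfolding cells_def by blast
      then show False using j(2) by linarith
    qed
    then have "cells n a = {}" by blast
    then have "xsum n a \<rho> = (0 :: 'k tpoly)" for \<rho> by (simp add: xsum_def)
    then show ?thesis using is_ideal_zero[OF H] by (simp add: xswap_def)
  next
    case False
    \<comment> \<open>The cell behind an index: + becomes the last value, which is unambiguous
      because the other entries are below \<open>a j\<close>.\<close>
    define h where "h \<sigma> j = (case \<sigma> j of None \<Rightarrow> plusval n a j | Some c \<Rightarrow> c)" for \<sigma> :: "nat \<Rightarrow> nat option" and j
    have h: "h \<sigma> \<in> face_cells n a (F i)" "to_opt n a (h \<sigma>) = \<sigma>"
      if \<sigma>: "\<forall>j. \<sigma> j \<in> (if j \<in> F i then insert None (Some ` {1..<a j}) else {None})" for \<sigma>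
    proof -
      have c: "\<sigma> j = None \<or> (\<exists>c. \<sigma> j = Some c \<and> 1 \<le> c \<and> c < a j \<and> j \<in> F i)" for j
        using \<sigma>[rule_format, of j] by (auto split: if_splits)
      have "h \<sigma> j \<in> cellvals n a j" for j
        using c[of j] G False by (auto simp: h_def cellvals_def plusval_def Suc_le_eq)
      moreover have "supp (plusval n a) (h \<sigma>) \<subseteq> F i"
      proof
        fix j assume "j \<in> supp (plusval n a) (h \<sigma>)"
        then show "j \<in> F i" using c[of j] by (auto simp: supp_def h_def)
      qed
      ultimately show "h \<sigma> \<in> face_cells n a (F i)" by (simp add: cells_on_def)
      show "to_opt n a (h \<sigma>) = \<sigma>"
      proof
        fix j show "to_opt n a (h \<sigma>) j = \<sigma> j"
          using c[of j] G(1) by (auto simp: to_opt_def h_def plusval_def)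
      qed
    qed
    have "xswap n a \<sigma> \<tau> l \<in> swap_binomials n a F"
      unfolding swap_binomials_def
    proof (intro CollectI exI conjI)
      show "xswap n a \<sigma> \<tau> l = newvar n a (h \<sigma>) * newvar n a (h \<tau>) -
          newvar n a ((h \<sigma>)(l := h \<tau> l)) * newvar n a ((h \<tau>)(l := h \<sigma> l))"
        unfolding swap_binomial_eq_xswap[OF h(1)[OF \<sigma>] h(1)[OF \<tau>]] h(2)[OF \<sigma>] h(2)[OF \<tau>] ..
    qed (rule G(2) h(1)[OF \<sigma>] h(1)[OF \<tau>])+
    then show ?thesis using bin by blast
  qed
qed (use H \<sigma> \<tau> in \<open>auto simp: opts_def\<close>)

text \<open>The margin of a face J has the entries of a containing facet with + at the missing
  coordinates. So the minors of all faces are reached by extension from the binomials of the facets,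
  and those binomials in turn from the minors of the facets.\<close>

lemma I_Delta_eq:
  assumes sub: "\<And>J. J \<in> \<Delta> \<Longrightarrow> \<exists>i<3. J \<subseteq> F i" and F: "\<And>i. i < 3 \<Longrightarrow> F i \<in> \<Delta> \<and> F i \<subseteq> {1..n}"
  shows "I_Delta n a \<Delta> = ideal_gen (swap_binomials n a F :: 'k::comm_ring_1 tpoly set)"
proof
  show "I_Delta n a \<Delta> \<subseteq> ideal_gen (swap_binomials n a F :: 'k tpoly set)"
    unfolding I_Delta_def
  proof (rule ideal_gen_least[OF is_ideal_ideal_gen], rule subsetI)
    fix f :: "'k tpoly" assume "f \<in> (\<Union>J\<in>\<Delta>. margin_minors n a J)"
    then obtain J i k l where J: "J \<in> \<Delta>" and f: "f = margin n a J i * margin n a J k -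
        margin n a J (k(l := i l)) * margin n a J (i(l := k l))"
      and ik: "\<forall>r\<in>J. 1 \<le> i r \<and> i r \<le> a r" "\<forall>r\<in>J. 1 \<le> k r \<and> k r \<le> a r" and l: "l \<in> J"
      unfolding margin_minors_def by blast
    obtain r where r: "r < 3" "J \<subseteq> F r" using sub[OF J] by blast
    define \<sigma> \<tau> where "\<sigma> = (\<lambda>j. if j \<in> J then Some (i j) else None)"
      and "\<tau> = (\<lambda>j. if j \<in> J then Some (k j) else None)"
    have m: "(\<lambda>j. if j \<in> J then Some ((k(l := i l)) j) else None) = \<tau>(l := \<sigma> l)"
      "(\<lambda>j. if j \<in> J then Some ((i(l := k l)) j) else None) = \<sigma>(l := \<tau> l)"
      using l by (auto simp: \<sigma>_def \<tau>_def)
    have "f = xswap n a \<sigma> \<tau> l"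
      unfolding f margin_def m xswap_def \<sigma>_def[symmetric] \<tau>_def[symmetric] by (simp add: mult.commute)
    moreover have "xswap n a \<sigma> \<tau> l \<in> ideal_gen (swap_binomials n a F :: 'k tpoly set)"
    proof (rule xswap_in_if_binomials[where i = r])
      show "\<sigma> j \<in> opts a (F r) j" "\<tau> j \<in> opts a (F r) j" for j
        using ik r(2) by (auto simp: \<sigma>_def \<tau>_def opts_def)
    qed (use F r in \<open>auto simp: is_ideal_ideal_gen ideal_gen_incl\<close>)
    ultimately show "f \<in> ideal_gen (swap_binomials n a F)" by simp
  qed
  show "ideal_gen (swap_binomials n a F :: 'k tpoly set) \<subseteq> I_Delta n a \<Delta>"
    unfolding I_Delta_def
  proof (rule ideal_gen_least[OF is_ideal_ideal_gen], rule subsetI)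
    fix f :: "'k tpoly" assume "f \<in> swap_binomials n a F"
    then obtain i \<sigma> \<tau> l where f: "f = newvar n a \<sigma> * newvar n a \<tau> -
        newvar n a (\<sigma>(l := \<tau> l)) * newvar n a (\<tau>(l := \<sigma> l))"
      and i: "i < 3" "\<sigma> \<in> face_cells n a (F i)" "\<tau> \<in> face_cells n a (F i)"
      unfolding swap_binomials_def by blast
    have o: "to_opt n a \<rho> j \<in> opts a (F i) j" if \<rho>: "\<rho> \<in> face_cells n a (F i)" for \<rho> j
    proof (cases "\<rho> j = plusval n a j")
      case False
      then have "j \<in> F i" "j \<in> {1..n}" using \<rho> F[OF i(1)] by (auto simp: cells_on_def supp_def)
      moreover have "\<rho> j \<in> cellvals n a j" using \<rho> by (simp add: cells_on_def)
      ultimately show ?thesis using False by (auto simp: to_opt_def opts_def cellvals_def)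
    qed (simp add: to_opt_def opts_def)
    have "f = xswap n a (to_opt n a \<sigma>) (to_opt n a \<tau>) l"
      unfolding f by (rule swap_binomial_eq_xswap[OF i(2,3)])
    moreover have "\<dots> \<in> ideal_gen (\<Union>J\<in>\<Delta>. margin_minors n a J)"
    proof (rule xswap_in_if_minors[where G = "F i"])
      show "margin_minors n a (F i) \<subseteq> ideal_gen (\<Union>J\<in>\<Delta>. margin_minors n a J)"
        using F[OF i(1)] by (auto intro!: ideal_gen_incl)
    qed (use o i F in \<open>auto simp: is_ideal_ideal_gen\<close>)
    ultimately show "f \<in> ideal_gen (\<Union>J\<in>\<Delta>. margin_minors n a J)" by simp
  qed
qed

section \<open>The facets as a family indexed by 0, 1, 2\<close>

lemma facets_enum:
  assumes \<Delta>: "simplicial_complex \<Delta>" "\<forall>F\<in>\<Delta>. F \<subseteq> {1..n}" "card (facets \<Delta>) \<le> 3"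
  shows "\<exists>F :: nat \<Rightarrow> nat set. (\<forall>i<3. F i \<in> \<Delta>) \<and> (\<forall>J\<in>\<Delta>. \<exists>i<3. J \<subseteq> F i)"
proof -
  have "\<Delta> \<subseteq> Pow {1..n}" using \<Delta>(2) by auto
  then have fin: "finite \<Delta>" by (rule finite_subset) simp
  have ex: "\<exists>G\<in>facets \<Delta>. J \<subseteq> G" if J: "J \<in> \<Delta>" for J
  proof -
    obtain G where G: "G \<in> \<Delta>" "J \<subseteq> G" "\<forall>K\<in>\<Delta>. G \<subseteq> K \<longrightarrow> G = K"
      using finite_has_maximal2[OF fin J] by auto
    then have "G \<in> facets \<Delta>" by (simp add: facets_def) metis
    then show ?thesis using G(2) by blast
  qed
  obtain J0 where "J0 \<in> \<Delta>" using \<Delta>(1) by (auto simp: simplicial_complex_def)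
  then have ne: "facets \<Delta> \<noteq> {}" using ex[of J0] by blast
  have "finite (facets \<Delta>)" using fin by (simp add: facets_def)
  then obtain l where l: "set l = facets \<Delta>" "distinct l" using finite_distinct_list by blast
  have len: "length l \<le> 3" "l \<noteq> []" using l \<Delta>(3) ne distinct_card[OF l(2)] by auto
  \<comment> \<open>Fewer than three facets are padded by repeating the first; the list is nonempty
    since a complex is nonempty.\<close>
  define F where "F i = (if i < length l then l ! i else l ! 0)" for i
  have "F i \<in> set l" for i using len by (auto simp: F_def)
  then have "\<forall>i<3. F i \<in> \<Delta>" using l by (auto simp: facets_def)
  moreover have "\<exists>i<3. J \<subseteq> F i" if J: "J \<in> \<Delta>" for J
  proof -
    obtain G where G: "G \<in> set l" "J \<subseteq> G" using ex[OF J] l by auto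
    then obtain i where i: "i < length l" "l ! i = G" by (auto simp: in_set_conv_nth)
    then have "i < 3" "F i = G" using len by (auto simp: F_def)
    then show ?thesis using G by blast
  qed
  ultimately show ?thesis by blast
qed

theorem theorem7p8:
  fixes n :: nat and a :: "nat \<Rightarrow> nat" and \<Delta> :: "nat set set"
  assumes "simplicial_complex \<Delta>"
    and "\<forall>F\<in>\<Delta>. F \<subseteq> {1..n}"
    and "card (facets \<Delta>) \<le> 3"
  shows "radical_ideal (I_Delta n a \<Delta> :: 'k::field tpoly set)"
proof -
  obtain F :: "nat \<Rightarrow> nat set" where F: "\<forall>i<3. F i \<in> \<Delta>" "\<forall>J\<in>\<Delta>. \<exists>i<3. J \<subseteq> F i"
    using facets_enum[OF assms] by blast
  have sub: "F i \<subseteq> {1..n}" if "i < 3" for i using F(1) that assms(2) by blast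
  have fin: "finite (F i)" if "i < 3" for i by (rule finite_subset[OF sub[OF that]]) simp
  have "I_Delta n a \<Delta> = ideal_gen (swap_binomials n a F :: 'k tpoly set)"
    by (rule I_Delta_eq) (use F sub in auto)
  then show ?thesis using radical_swap_binomials[where F = F, OF fin] by simp
qed

end
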